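(* Let $\mathcal{C}$ be an additive category with an exact structure $\mathcal{D}$. Then there are bijective correspondences between: (1) $\mathcal{D}$-cotorsion pairs in $\mathcal{C}$; (2) $\mathcal{D}$-projectively generated Xu exact structures on $\mathcal{C}$; (3) $\mathcal{D}$-injectively generated Xu exact structures on $\mathcal{C}$.
   Context: An exact structure $\mathcal{E}$ on an additive category $\mathcal{C}$ (Quillen, with Keller's axioms) is a distinguished class of kernel-cokernel pairs $X\rightarrowtail Y\twoheadrightarrow Z$, called $\mathcal{E}$-conflations (their kernels are $\mathcal{E}$-inflations, their cokernels $\mathcal{E}$-deflations), such that: $1_0$ is a deflation; deflations are closed under composition; pullbacks of deflations along arbitrary morphisms exist and are deflations; pushouts of inflations along arbitrary morphisms exist and are inflations. $\mathrm{Ext}^1_{\mathcal{D}}(-,-)$ is the Yoneda bifunctor; $\mathrm{Ext}^1_{\mathcal{D}}(Z,X)=0$ iff every $\mathcal{D}$-conflation $X\rightarrowtail Y\twoheadrightarrow Z$ splits. For a class $\mathcal{A}$ of objects, $\mathcal{A}^{\perp_{\mathcal{D}}}=\{X\mid \mathrm{Ext}^1_{\mathcal{D}}(A,X)=0\ \forall A\in\mathcal{A}\}$ and ${}^{\perp_{\mathcal{D}}}\mathcal{A}=\{X\mid \mathrm{Ext}^1_{\mathcal{D}}(X,A)=0\ \forall A\in\mathcal{A}\}$. A $\mathcal{D}$-cotorsion pair is a pair $(\mathcal{A},\mathcal{B})$ of classes of objects with $\mathcal{A}^{\perp_{\mathcal{D}}}=\mathcal{B}$ and ${}^{\perp_{\mathcal{D}}}\mathcal{B}=\mathcal{A}$.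 An exact structure $\mathcal{E}$ is $\mathcal{D}$-projectively generated if for some class $\mathcal{M}$ of objects it consists of the $\mathcal{D}$-conflations $X\to Y\to Z$ such that $0\to\mathrm{Hom}(M,X)\to\mathrm{Hom}(M,Y)\to\mathrm{Hom}(M,Z)\to 0$ is exact for every $M\in\mathcal{M}$; it is $\mathcal{D}$-injectively generated if for some class $\mathcal{M}$ it consists of the $\mathcal{D}$-conflations $X\to Y\to Z$ such that $0\to\mathrm{Hom}(Z,M)\to\mathrm{Hom}(Y,M)\to\mathrm{Hom}(X,M)\to 0$ is exact for every $M\in\mathcal{M}$. An object $X$ is $\mathcal{D}$-$\mathcal{E}$-divisible if every $\mathcal{D}$-inflation $X\rightarrowtail Y$ is an $\mathcal{E}$-inflation, and $\mathcal{D}$-$\mathcal{E}$-flat if every $\mathcal{D}$-deflation $Y\twoheadrightarrow X$ is an $\mathcal{E}$-deflation; $Div(\mathcal{D}\textrm{-}\mathcal{E})$ and $Flat(\mathcal{D}\textrm{-}\mathcal{E})$ denote the corresponding classes. $Proj(\mathcal{E})$ (resp. $Inj(\mathcal{E})$) is the class of $\mathcal{E}$-projective (resp. $\mathcal{E}$-injective) objects, i.e. objects $X$ such that every $\mathcal{E}$-conflation ending (resp. starting) with $X$ splits. A $\mathcal{D}$-projectively generated exact structure $\mathcal{E}$ is called a Xu exact structure if $Proj(\mathcal{E})={}^{\perp_{\mathcal{D}}}Div(\mathcal{D}\textrm{-}\mathcal{E})$. A $\mathcal{D}$-injectively generated exact structure $\mathcal{E}$ is called a Xu exact structure if $Inj(\mathcal{E})=Flat(\mathcal{D}\textrm{-}\mathcal{E})^{\perp_{\mathcal{D}}}$.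 *)

theory Defs
  imports "HOL-Algebra.Exact_Sequence"
begin

section \<open>Additive categories\<close>

text \<open>
  Arrows know their domain and codomain, so distinct Hom-sets are disjoint. Composition,
  addition and the zero arrows are only meaningful on the carriers.
\<close>

record ('o, 'm) precategory =
  Obj :: "'o set"
  Arr :: "'m set"
  Dom :: "'m \<Rightarrow> 'o"
  Cod :: "'m \<Rightarrow> 'o"
  Ident :: "'o \<Rightarrow> 'm"
  Comp :: "'m \<Rightarrow> 'm \<Rightarrow> 'm"  (infixl "\<cdot>\<index>" 70)
  Plus :: "'m \<Rightarrow> 'm \<Rightarrow> 'm"  (infixl "\<boxplus>\<index>" 65)
  Null :: "'o \<Rightarrow> 'o \<Rightarrow> 'm"

definition Hom :: "('o, 'm) precategory \<Rightarrow> 'o \<Rightarrow> 'o \<Rightarrow> 'm set" where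
  "Hom C X Y = {f \<in> Arr C. Dom C f = X \<and> Cod C f = Y}"

definition Hom_group :: "('o, 'm) precategory \<Rightarrow> 'o \<Rightarrow> 'o \<Rightarrow> 'm monoid" where
  "Hom_group C X Y = \<lparr>carrier = Hom C X Y, mult = Plus C, one = Null C X Y\<rparr>"

definition iso_arrow :: "('o, 'm) precategory \<Rightarrow> 'm \<Rightarrow> 'o \<Rightarrow> 'o \<Rightarrow> bool" where
  "iso_arrow C f X Y \<longleftrightarrow> f \<in> Hom C X Y \<and>
     (\<exists>g \<in> Hom C Y X. g \<cdot>\<^bsub>C\<^esub> f = Ident C X \<and> f \<cdot>\<^bsub>C\<^esub> g = Ident C Y)"

definition zero_object :: "('o, 'm) precategory \<Rightarrow> 'o \<Rightarrow> bool" where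
  "zero_object C Z \<longleftrightarrow> Z \<in> Obj C \<and>
     (\<forall>X \<in> Obj C. (\<exists>!f. f \<in> Hom C X Z) \<and> (\<exists>!f. f \<in> Hom C Z X))"

definition biproduct ::
  "('o, 'm) precategory \<Rightarrow> 'o \<Rightarrow> 'o \<Rightarrow> 'o \<Rightarrow> 'm \<Rightarrow> 'm \<Rightarrow> 'm \<Rightarrow> 'm \<Rightarrow> bool" where
  "biproduct C X Y P i j p q \<longleftrightarrow>
     P \<in> Obj C \<and> i \<in> Hom C X P \<and> j \<in> Hom C Y P \<and> p \<in> Hom C P X \<and> q \<in> Hom C P Y \<and>
     p \<cdot>\<^bsub>C\<^esub> i = Ident C X \<and> q \<cdot>\<^bsub>C\<^esub> j = Ident C Y \<and>
     q \<cdot>\<^bsub>C\<^esub> i = Null C X Y \<and> p \<cdot>\<^bsub>C\<^esub> j = Null C Y X \<and>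
     (i \<cdot>\<^bsub>C\<^esub> p) \<boxplus>\<^bsub>C\<^esub> (j \<cdot>\<^bsub>C\<^esub> q) = Ident C P"

locale additive_category =
  fixes C :: "('o, 'm) precategory" (structure)
  assumes Dom_Obj: "f \<in> Arr C \<Longrightarrow> Dom C f \<in> Obj C"
    and Cod_Obj: "f \<in> Arr C \<Longrightarrow> Cod C f \<in> Obj C"
    and Ident_Hom: "X \<in> Obj C \<Longrightarrow> Ident C X \<in> Hom C X X"
    and Comp_Hom: "\<lbrakk>f \<in> Hom C X Y; g \<in> Hom C Y Z\<rbrakk> \<Longrightarrow> g \<cdot> f \<in> Hom C X Z"
    and Comp_assoc: "\<lbrakk>f \<in> Hom C W X; g \<in> Hom C X Y; h \<in> Hom C Y Z\<rbrakk> \<Longrightarrow> (h \<cdot> g) \<cdot> f = h \<cdot> (g \<cdot> f)"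
    and Comp_Ident_right: "f \<in> Hom C X Y \<Longrightarrow> f \<cdot> Ident C X = f"
    and Comp_Ident_left: "f \<in> Hom C X Y \<Longrightarrow> Ident C Y \<cdot> f = f"
    and Hom_comm_group: "\<lbrakk>X \<in> Obj C; Y \<in> Obj C\<rbrakk> \<Longrightarrow> comm_group (Hom_group C X Y)"
    and Comp_Plus_right:
      "\<lbrakk>f \<in> Hom C X Y; f' \<in> Hom C X Y; g \<in> Hom C Y Z\<rbrakk> \<Longrightarrow> g \<cdot> (f \<boxplus> f') = (g \<cdot> f) \<boxplus> (g \<cdot> f')"
    and Comp_Plus_left:
      "\<lbrakk>f \<in> Hom C X Y; g \<in> Hom C Y Z; g' \<in> Hom C Y Z\<rbrakk> \<Longrightarrow> (g \<boxplus> g') \<cdot> f = (g \<cdot> f) \<boxplus> (g' \<cdot> f)"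
    and zero_object_exists: "\<exists>Z. zero_object C Z"
    and biproduct_exists: "\<lbrakk>X \<in> Obj C; Y \<in> Obj C\<rbrakk> \<Longrightarrow> \<exists>P i j p q. biproduct C X Y P i j p q"


section \<open>Exact structures\<close>

definition is_kernel :: "('o, 'm) precategory \<Rightarrow> 'm \<Rightarrow> 'm \<Rightarrow> bool" where
  "is_kernel C f g \<longleftrightarrow> f \<in> Arr C \<and> g \<in> Arr C \<and> Cod C f = Dom C g \<and>
     g \<cdot>\<^bsub>C\<^esub> f = Null C (Dom C f) (Cod C g) \<and>
     (\<forall>W \<in> Obj C. \<forall>h \<in> Hom C W (Dom C g). g \<cdot>\<^bsub>C\<^esub> h = Null C W (Cod C g) \<longrightarrow>
        (\<exists>!k. k \<in> Hom C W (Dom C f) \<and> f \<cdot>\<^bsub>C\<^esub> k = h))"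

definition is_cokernel :: "('o, 'm) precategory \<Rightarrow> 'm \<Rightarrow> 'm \<Rightarrow> bool" where
  "is_cokernel C g f \<longleftrightarrow> f \<in> Arr C \<and> g \<in> Arr C \<and> Cod C f = Dom C g \<and>
     g \<cdot>\<^bsub>C\<^esub> f = Null C (Dom C f) (Cod C g) \<and>
     (\<forall>W \<in> Obj C. \<forall>h \<in> Hom C (Cod C f) W. h \<cdot>\<^bsub>C\<^esub> f = Null C (Dom C f) W \<longrightarrow>
        (\<exists>!k. k \<in> Hom C (Cod C g) W \<and> k \<cdot>\<^bsub>C\<^esub> g = h))"

definition kernel_cokernel_pair :: "('o, 'm) precategory \<Rightarrow> 'm \<Rightarrow> 'm \<Rightarrow> bool" where
  "kernel_cokernel_pair C f g \<longleftrightarrow> is_kernel C f g \<and> is_cokernel C g f"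

definition iso_pairs :: "('o, 'm) precategory \<Rightarrow> 'm \<times> 'm \<Rightarrow> 'm \<times> 'm \<Rightarrow> bool" where
  "iso_pairs C = (\<lambda>(f, g) (f', g').
     f \<in> Arr C \<and> g \<in> Arr C \<and> Cod C f = Dom C g \<and>
     f' \<in> Arr C \<and> g' \<in> Arr C \<and> Cod C f' = Dom C g' \<and>
     (\<exists>a b c. iso_arrow C a (Dom C f) (Dom C f') \<and> iso_arrow C b (Cod C f) (Cod C f') \<and>
        iso_arrow C c (Cod C g) (Cod C g') \<and>
        b \<cdot>\<^bsub>C\<^esub> f = f' \<cdot>\<^bsub>C\<^esub> a \<and> c \<cdot>\<^bsub>C\<^esub> g = g' \<cdot>\<^bsub>C\<^esub> b))"

text \<open>
  The square with sides \<open>g' : P \<rightarrow> Z'\<close>, \<open>h' : P \<rightarrow> Y\<close> over \<open>g : Y \<rightarrow> Z\<close>, \<open>h : Z' \<rightarrow> Z\<close>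
  (so \<open>g'\<close> is parallel to \<open>g\<close>), and dually for pushouts of \<open>f : X \<rightarrow> Y\<close>, \<open>h : X \<rightarrow> X'\<close>.
\<close>

definition is_pullback :: "('o, 'm) precategory \<Rightarrow> 'm \<Rightarrow> 'm \<Rightarrow> 'm \<Rightarrow> 'm \<Rightarrow> bool" where
  "is_pullback C g h g' h' \<longleftrightarrow>
     g \<in> Arr C \<and> h \<in> Arr C \<and> g' \<in> Arr C \<and> h' \<in> Arr C \<and>
     Cod C g = Cod C h \<and> Dom C g' = Dom C h' \<and> Cod C g' = Dom C h \<and> Cod C h' = Dom C g \<and>
     g \<cdot>\<^bsub>C\<^esub> h' = h \<cdot>\<^bsub>C\<^esub> g' \<and>
     (\<forall>W \<in> Obj C. \<forall>u \<in> Hom C W (Dom C g). \<forall>v \<in> Hom C W (Dom C h). g \<cdot>\<^bsub>C\<^esub> u = h \<cdot>\<^bsub>C\<^esub> v \<longrightarrow>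
        (\<exists>!k. k \<in> Hom C W (Dom C g') \<and> h' \<cdot>\<^bsub>C\<^esub> k = u \<and> g' \<cdot>\<^bsub>C\<^esub> k = v))"

definition is_pushout :: "('o, 'm) precategory \<Rightarrow> 'm \<Rightarrow> 'm \<Rightarrow> 'm \<Rightarrow> 'm \<Rightarrow> bool" where
  "is_pushout C f h f' h' \<longleftrightarrow>
     f \<in> Arr C \<and> h \<in> Arr C \<and> f' \<in> Arr C \<and> h' \<in> Arr C \<and>
     Dom C f = Dom C h \<and> Cod C f' = Cod C h' \<and> Dom C f' = Cod C h \<and> Dom C h' = Cod C f \<and>
     h' \<cdot>\<^bsub>C\<^esub> f = f' \<cdot>\<^bsub>C\<^esub> h \<and>
     (\<forall>W \<in> Obj C. \<forall>u \<in> Hom C (Cod C f) W. \<forall>v \<in> Hom C (Cod C h) W. u \<cdot>\<^bsub>C\<^esub> f = v \<cdot>\<^bsub>C\<^esub> h \<longrightarrow>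
        (\<exists>!k. k \<in> Hom C (Cod C f') W \<and> k \<cdot>\<^bsub>C\<^esub> h' = u \<and> k \<cdot>\<^bsub>C\<^esub> f' = v))"

definition inflations :: "('m \<times> 'm) set \<Rightarrow> 'm set" where
  "inflations E = fst ` E"

definition deflations :: "('m \<times> 'm) set \<Rightarrow> 'm set" where
  "deflations E = snd ` E"

text \<open>
  A conflation \<open>X \<rightarrowtail> Y \<twoheadrightarrow> Z\<close> is stored as the pair of its two arrows. As usual for exact
  structures, the class of conflations is closed under isomorphism.
\<close>

definition exact_structure :: "('o, 'm) precategory \<Rightarrow> ('m \<times> 'm) set \<Rightarrow> bool" where
  "exact_structure C E \<longleftrightarrow>
     (\<forall>(f, g) \<in> E. kernel_cokernel_pair C f g) \<and>
     (\<forall>c \<in> E. \<forall>c'. iso_pairs C c c' \<longrightarrow> c' \<in> E) \<and>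
     (\<forall>Z. zero_object C Z \<longrightarrow> Ident C Z \<in> deflations E) \<and>
     (\<forall>g \<in> deflations E. \<forall>g' \<in> deflations E. Dom C g' = Cod C g \<longrightarrow> g' \<cdot>\<^bsub>C\<^esub> g \<in> deflations E) \<and>
     (\<forall>g \<in> deflations E. \<forall>h \<in> Arr C. Cod C h = Cod C g \<longrightarrow>
        (\<exists>g' h'. is_pullback C g h g' h' \<and> g' \<in> deflations E)) \<and>
     (\<forall>f \<in> inflations E. \<forall>h \<in> Arr C. Dom C h = Dom C f \<longrightarrow>
        (\<exists>f' h'. is_pushout C f h f' h' \<and> f' \<in> inflations E))"

definition splits :: "('o, 'm) precategory \<Rightarrow> 'm \<Rightarrow> 'm \<Rightarrow> bool" where
  "splits C f g \<longleftrightarrow> (\<exists>r s. biproduct C (Dom C f) (Cod C g) (Cod C f) f s r g)"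


section \<open>Yoneda extensions and cotorsion pairs\<close>

definition conflations_between ::
  "('o, 'm) precategory \<Rightarrow> ('m \<times> 'm) set \<Rightarrow> 'o \<Rightarrow> 'o \<Rightarrow> ('m \<times> 'm) set" where
  "conflations_between C D X Z = {(f, g) \<in> D. Dom C f = X \<and> Cod C g = Z}"

definition Yoneda_equiv ::
  "('o, 'm) precategory \<Rightarrow> ('m \<times> 'm) set \<Rightarrow> 'o \<Rightarrow> 'o \<Rightarrow> (('m \<times> 'm) \<times> ('m \<times> 'm)) set" where
  "Yoneda_equiv C D X Z = {((f, g), (f', g')).
     (f, g) \<in> conflations_between C D X Z \<and> (f', g') \<in> conflations_between C D X Z \<and>
     (\<exists>h. iso_arrow C h (Cod C f) (Cod C f') \<and> h \<cdot>\<^bsub>C\<^esub> f = f' \<and> g' \<cdot>\<^bsub>C\<^esub> h = g)}"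

text \<open>
  Only the underlying set of the group \<open>Ext\<^sup>1(Z,X)\<close> and its zero element, the class of the
  split conflations, are needed: the group vanishes iff that element is its only one.
\<close>

definition Ext1 :: "('o, 'm) precategory \<Rightarrow> ('m \<times> 'm) set \<Rightarrow> 'o \<Rightarrow> 'o \<Rightarrow> ('m \<times> 'm) set set" where
  "Ext1 C D Z X = conflations_between C D X Z // Yoneda_equiv C D X Z"

definition Ext1_zero :: "('o, 'm) precategory \<Rightarrow> ('m \<times> 'm) set \<Rightarrow> 'o \<Rightarrow> 'o \<Rightarrow> ('m \<times> 'm) set" where
  "Ext1_zero C D Z X = {(f, g) \<in> conflations_between C D X Z. splits C f g}"

definition Ext1_vanishes :: "('o, 'm) precategory \<Rightarrow> ('m \<times> 'm) set \<Rightarrow> 'o \<Rightarrow> 'o \<Rightarrow> bool" where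
  "Ext1_vanishes C D Z X \<longleftrightarrow> Ext1 C D Z X = {Ext1_zero C D Z X}"

definition right_perp :: "('o, 'm) precategory \<Rightarrow> ('m \<times> 'm) set \<Rightarrow> 'o set \<Rightarrow> 'o set" where
  "right_perp C D \<A> = {X \<in> Obj C. \<forall>A \<in> \<A>. Ext1_vanishes C D A X}"

definition left_perp :: "('o, 'm) precategory \<Rightarrow> ('m \<times> 'm) set \<Rightarrow> 'o set \<Rightarrow> 'o set" where
  "left_perp C D \<A> = {X \<in> Obj C. \<forall>A \<in> \<A>. Ext1_vanishes C D X A}"

definition cotorsion_pairs :: "('o, 'm) precategory \<Rightarrow> ('m \<times> 'm) set \<Rightarrow> ('o set \<times> 'o set) set" where
  "cotorsion_pairs C D = {(\<A>, \<B>). \<A> \<subseteq> Obj C \<and> \<B> \<subseteq> Obj C \<and>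
     right_perp C D \<A> = \<B> \<and> left_perp C D \<B> = \<A>}"


section \<open>Projectively and injectively generated exact structures\<close>

text \<open>
  The library predicate \<open>short_exact_sequence\<close> lists its groups and maps from right to left.
\<close>

definition proj_generated ::
  "('o, 'm) precategory \<Rightarrow> ('m \<times> 'm) set \<Rightarrow> 'o set \<Rightarrow> ('m \<times> 'm) set" where
  "proj_generated C D \<M> = {(f, g) \<in> D. \<forall>M \<in> \<M>.
     short_exact_sequence
       (Hom_group C M (Cod C g)) (Hom_group C M (Cod C f)) (Hom_group C M (Dom C f))
       (\<lambda>u. g \<cdot>\<^bsub>C\<^esub> u) (\<lambda>u. f \<cdot>\<^bsub>C\<^esub> u)}"

definition inj_generated ::
  "('o, 'm) precategory \<Rightarrow> ('m \<times> 'm) set \<Rightarrow> 'o set \<Rightarrow> ('m \<times> 'm) set" where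
  "inj_generated C D \<M> = {(f, g) \<in> D. \<forall>M \<in> \<M>.
     short_exact_sequence
       (Hom_group C (Dom C f) M) (Hom_group C (Cod C f) M) (Hom_group C (Cod C g) M)
       (\<lambda>u. u \<cdot>\<^bsub>C\<^esub> f) (\<lambda>u. u \<cdot>\<^bsub>C\<^esub> g)}"

definition projectively_generated ::
  "('o, 'm) precategory \<Rightarrow> ('m \<times> 'm) set \<Rightarrow> ('m \<times> 'm) set \<Rightarrow> bool" where
  "projectively_generated C D E \<longleftrightarrow> exact_structure C E \<and> (\<exists>\<M> \<subseteq> Obj C. E = proj_generated C D \<M>)"

definition injectively_generated ::
  "('o, 'm) precategory \<Rightarrow> ('m \<times> 'm) set \<Rightarrow> ('m \<times> 'm) set \<Rightarrow> bool" where
  "injectively_generated C D E \<longleftrightarrow> exact_structure C E \<and> (\<exists>\<M> \<subseteq> Obj C. E = inj_generated C D \<M>)"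

definition Div :: "('o, 'm) precategory \<Rightarrow> ('m \<times> 'm) set \<Rightarrow> ('m \<times> 'm) set \<Rightarrow> 'o set" where
  "Div C D E = {X \<in> Obj C. \<forall>f \<in> inflations D. Dom C f = X \<longrightarrow> f \<in> inflations E}"

definition Flat :: "('o, 'm) precategory \<Rightarrow> ('m \<times> 'm) set \<Rightarrow> ('m \<times> 'm) set \<Rightarrow> 'o set" where
  "Flat C D E = {X \<in> Obj C. \<forall>g \<in> deflations D. Cod C g = X \<longrightarrow> g \<in> deflations E}"

definition Proj :: "('o, 'm) precategory \<Rightarrow> ('m \<times> 'm) set \<Rightarrow> 'o set" where
  "Proj C E = {X \<in> Obj C. \<forall>(f, g) \<in> E. Cod C g = X \<longrightarrow> splits C f g}"

definition Inj :: "('o, 'm) precategory \<Rightarrow> ('m \<times> 'm) set \<Rightarrow> 'o set" where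
  "Inj C E = {X \<in> Obj C. \<forall>(f, g) \<in> E. Dom C f = X \<longrightarrow> splits C f g}"

definition proj_Xu_structures ::
  "('o, 'm) precategory \<Rightarrow> ('m \<times> 'm) set \<Rightarrow> ('m \<times> 'm) set set" where
  "proj_Xu_structures C D =
     {E. projectively_generated C D E \<and> Proj C E = left_perp C D (Div C D E)}"

definition inj_Xu_structures ::
  "('o, 'm) precategory \<Rightarrow> ('m \<times> 'm) set \<Rightarrow> ('m \<times> 'm) set set" where
  "inj_Xu_structures C D =
     {E. injectively_generated C D E \<and> Inj C E = right_perp C D (Flat C D E)}"

end

theory Submission
  imports Defs
begin

text \<open>
  Write \<open>E\<close> for the structure projectively generated by a class \<open>\<M>\<close>. Pulling back along an
  arrow from a member of \<open>\<M>\<close> turns a lifting problem into a splitting problem, so \<open>Div E\<close> is the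
  right orthogonal of \<open>\<M>\<close>, and \<open>\<M> \<subseteq> Proj E \<subseteq> left_perp (Div E)\<close>. Hence \<open>(\<A>, \<B>)\<close> is recovered
  as \<open>(Proj E, Div E)\<close> from the structure generated by \<open>\<A>\<close>. Conversely \<open>E\<close> is generated by
  \<open>Proj E\<close>, and the Xu condition says precisely that \<open>(Proj E, Div E)\<close> is a cotorsion pair. The
  injective case is the same statement in the opposite category.
\<close>

section \<open>Additive categories\<close>

text \<open>A lift of \<open>u\<close> through a deflation \<open>g\<close> amounts to a section of
  the pullback of \<open>g\<close> along \<open>u\<close>. To use this, the pullback must also keep
  the kernel object, so that a hypothesis on \<open>Ext1\<close> at that fixed object applies to it.
  Two obstacles shape the rest. \<open>Ext1\<close> is a set of classes that has to consist of
  exactly the zero class, so its vanishing includes the existence of a split conflation between the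
  given objects. And each generated class must itself be an exact structure, where composition of
  deflations does not dualize; hence the correspondences are established for classes without that
  axiom, and exactness is checked separately for both kinds of generation.\<close>

context additive_category
begin

lemma HomD:
  assumes "f \<in> Hom C X Y"
  shows "f \<in> Arr C" "Dom C f = X" "Cod C f = Y" "X \<in> Obj C" "Y \<in> Obj C"
  using assms Dom_Obj Cod_Obj by (auto simp: Hom_def)

lemma Arr_Hom: "f \<in> Arr C \<Longrightarrow> f \<in> Hom C (Dom C f) (Cod C f)"
  by (simp add: Hom_def)

lemma Null_Hom: "\<lbrakk>X \<in> Obj C; Y \<in> Obj C\<rbrakk> \<Longrightarrow> Null C X Y \<in> Hom C X Y"
  using monoid.one_closed[OF group.is_monoid[OF comm_group.axioms(2)[OF Hom_comm_group]]]
  by (simp add: Hom_group_def)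

text \<open>Fixing one arrow makes \<open>X\<close> and \<open>Y\<close> objects, so the group laws
  of \<open>Hom C X Y\<close> can be interpreted once and exported with membership of arrows as
  their only hypothesis.\<close>

context
  fixes f X Y
  assumes f: "f \<in> Hom C X Y"
begin

interpretation G: comm_group "Hom_group C X Y"
  using Hom_comm_group[of X Y] HomD[OF f] by simp

lemma Plus_Null_left: "Null C X Y \<boxplus> f = f"
  using G.l_one[of f] f by (simp add: Hom_group_def)

lemma Plus_Null_right: "f \<boxplus> Null C X Y = f"
  using G.r_one[of f] f by (simp add: Hom_group_def)

context
  fixes g
  assumes g: "g \<in> Hom C X Y"
begin

lemma Plus_Hom: "f \<boxplus> g \<in> Hom C X Y"
  using G.m_closed[of f g] f g by (simp add: Hom_group_def)

lemma Plus_comm: "f \<boxplus> g = g \<boxplus> f"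
  using G.m_comm[of f g] f g by (simp add: Hom_group_def)

lemma Plus_eq_right_imp_Null: "f \<boxplus> g = g \<Longrightarrow> f = Null C X Y"
  using G.r_cancel_one[of g f] f g by (simp add: Hom_group_def)

text \<open>The operations of the category include no negation; subtraction enters later proofs only
  through this statement.\<close>

lemma difference: "\<exists>d \<in> Hom C X Y. d \<boxplus> g = f"
proof -
  define d where "d = f \<otimes>\<^bsub>Hom_group C X Y\<^esub> inv\<^bsub>Hom_group C X Y\<^esub> g"
  have c: "f \<in> carrier (Hom_group C X Y)" "g \<in> carrier (Hom_group C X Y)"
    using f g by (auto simp: Hom_group_def)
  then have "d \<in> carrier (Hom_group C X Y)" "d \<otimes>\<^bsub>Hom_group C X Y\<^esub> g = f"
    by (auto simp: d_def G.m_assoc)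
  then show ?thesis by (auto simp: Hom_group_def)
qed

end

end

lemma Comp_Null_right:
  assumes "g \<in> Hom C Y Z" "X \<in> Obj C"
  shows "g \<cdot> Null C X Y = Null C X Z"
proof -
  have n: "Null C X Y \<in> Hom C X Y" using assms HomD Null_Hom by blast
  have "g \<cdot> Null C X Y \<boxplus> g \<cdot> Null C X Y = g \<cdot> (Null C X Y \<boxplus> Null C X Y)"
    using Comp_Plus_right[OF n n assms(1)] by simp
  also have "\<dots> = g \<cdot> Null C X Y" using Plus_Null_left[OF n] by simp
  finally show ?thesis
    using Plus_eq_right_imp_Null Comp_Hom[OF n assms(1)] by blast
qed

lemma Comp_Null_left:
  assumes "f \<in> Hom C X Y" "Z \<in> Obj C"
  shows "Null C Y Z \<cdot> f = Null C X Z"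
proof -
  have n: "Null C Y Z \<in> Hom C Y Z" using assms HomD Null_Hom by blast
  have "Null C Y Z \<cdot> f \<boxplus> Null C Y Z \<cdot> f = (Null C Y Z \<boxplus> Null C Y Z) \<cdot> f"
    using Comp_Plus_left[OF assms(1) n n] by simp
  also have "\<dots> = Null C Y Z \<cdot> f" using Plus_Null_left[OF n] by simp
  finally show ?thesis
    using Plus_eq_right_imp_Null Comp_Hom[OF assms(1) n] by blast
qed

lemma iso_arrow_Ident: "X \<in> Obj C \<Longrightarrow> iso_arrow C (Ident C X) X X"
  unfolding iso_arrow_def using Ident_Hom Comp_Ident_left by blast

section \<open>Kernels, cokernels and pullbacks\<close>

lemma kernel_lift:
  assumes "is_kernel C f g" "f \<in> Hom C X Y" "g \<in> Hom C Y Z" "h \<in> Hom C W Y" "g \<cdot> h = Null C W Z"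
  shows "\<exists>k \<in> Hom C W X. f \<cdot> k = h"
  using assms HomD(4)[OF assms(4)] HomD[OF assms(2)] HomD[OF assms(3)] unfolding is_kernel_def by (simp, blast)

text \<open>Both \<open>k\<close> and \<open>k'\<close> are factorizations of the arrow
  \<open>f \<cdot> k'\<close>, which \<open>g\<close> annihilates, so the uniqueness clause of the
  kernel identifies them.\<close>

lemma kernel_mono:
  assumes "is_kernel C f g" "f \<in> Hom C X Y" "k \<in> Hom C W X" "k' \<in> Hom C W X" "f \<cdot> k = f \<cdot> k'"
  shows "k = k'"
proof -
  define Z where "Z = Cod C g"
  have g: "g \<in> Hom C Y Z" "g \<cdot> f = Null C X Z"
    using assms(1) HomD[OF assms(2)] by (auto simp: is_kernel_def Hom_def Z_def)
  have W: "W \<in> Obj C" using assms(3) by (rule HomD)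
  have "g \<cdot> (f \<cdot> k) = Null C W Z"
    using Comp_assoc[OF assms(3,2) g(1)] g(2) Comp_Null_left[OF assms(3) HomD(5)[OF g(1)]] by simp
  then have "\<exists>!k. k \<in> Hom C W X \<and> f \<cdot> k = f \<cdot> k'"
    using assms W Comp_Hom[OF assms(4,2)] HomD[OF assms(2)] HomD[OF g(1)]
    unfolding is_kernel_def by simp
  then show ?thesis using assms by blast
qed

lemma cokernel_factor:
  assumes "is_cokernel C g f" "f \<in> Hom C X Y" "g \<in> Hom C Y Z" "h \<in> Hom C Y W" "h \<cdot> f = Null C X W"
  shows "\<exists>k \<in> Hom C Z W. k \<cdot> g = h"
  using assms HomD(5)[OF assms(4)] HomD[OF assms(2)] HomD[OF assms(3)] unfolding is_cokernel_def by (simp, blast)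

lemma pullback_lift:
  assumes "is_pullback C g h g' h'" "u \<in> Hom C W (Dom C g)" "v \<in> Hom C W (Dom C h)"
    and "g \<cdot> u = h \<cdot> v"
  shows "\<exists>k \<in> Hom C W (Dom C g'). h' \<cdot> k = u \<and> g' \<cdot> k = v"
  using assms HomD(4)[OF assms(2)] unfolding is_pullback_def by blast

section \<open>Splitting\<close>

lemma split_section:
  assumes "splits C f g" "g \<in> Hom C Y Z"
  shows "\<exists>s \<in> Hom C Z Y. g \<cdot> s = Ident C Z"
proof -
  have "Cod C g = Z" using HomD(3)[OF assms(2)] .
  moreover obtain r s where b: "biproduct C (Dom C f) (Cod C g) (Cod C f) f s r g"
    using assms by (auto simp: splits_def)
  moreover from b have "Cod C f = Y"
    using HomD[OF assms(2)] by (auto simp: biproduct_def Hom_def)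
  ultimately show ?thesis by (auto simp: biproduct_def)
qed

text \<open>The arrow \<open>n\<close>, which is 1 - sg, is annihilated by \<open>g\<close> and so
  factors as \<open>f \<cdot> r\<close>. The remaining biproduct identities rf = 1 and rs = 0 are
  checked after composing with the monomorphism \<open>f\<close>.\<close>

lemma section_split:
  assumes kc: "kernel_cokernel_pair C f g"
    and f: "f \<in> Hom C X Y" and g: "g \<in> Hom C Y Z" and s: "s \<in> Hom C Z Y" and gs: "g \<cdot> s = Ident C Z"
  shows "splits C f g"
proof -
  have ker: "is_kernel C f g" and gf: "g \<cdot> f = Null C X Z"
    using kc HomD[OF f] HomD[OF g] by (auto simp: kernel_cokernel_pair_def is_kernel_def)
  note X = HomD(4)[OF f] and Y = HomD(4)[OF g] and Z = HomD(5)[OF g]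
  have sg: "s \<cdot> g \<in> Hom C Y Y" using Comp_Hom g s by blast
  obtain n where n: "n \<in> Hom C Y Y" and ns: "n \<boxplus> s \<cdot> g = Ident C Y"
    using difference[OF Ident_Hom[OF Y] sg] by blast
  have "g \<cdot> (s \<cdot> g) = g" using Comp_assoc[OF g s g] gs Comp_Ident_left[OF g] by simp
  then have "g \<cdot> n \<boxplus> g = g"
    using Comp_Plus_right[OF n sg g] ns Comp_Ident_right[OF g] by simp
  then have "g \<cdot> n = Null C Y Z" using Plus_eq_right_imp_Null Comp_Hom[OF n g] g by blast
  then obtain r where r: "r \<in> Hom C Y X" and fr: "f \<cdot> r = n"
    using kernel_lift[OF ker f g n] by blast
  have rf: "r \<cdot> f \<in> Hom C X X" and rs: "r \<cdot> s \<in> Hom C Z X" using Comp_Hom f r s by blast+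
  have "f \<cdot> (r \<cdot> f) \<boxplus> (s \<cdot> g) \<cdot> f = f"
    using Comp_Plus_left[OF f n sg] ns Comp_Ident_left[OF f] Comp_assoc[OF f r f] fr by simp
  moreover have "(s \<cdot> g) \<cdot> f = Null C X Y"
    using Comp_assoc[OF f g s] gf Comp_Null_right[OF s X] by simp
  moreover have frf: "f \<cdot> (r \<cdot> f) \<in> Hom C X Y" using Comp_Hom rf f by blast
  ultimately have "f \<cdot> (r \<cdot> f) = f \<cdot> Ident C X"
    using Plus_Null_right[OF frf] Comp_Ident_right[OF f] by simp
  then have 1: "r \<cdot> f = Ident C X" using kernel_mono[OF ker f rf Ident_Hom[OF X]] by blast
  have "f \<cdot> (r \<cdot> s) \<boxplus> (s \<cdot> g) \<cdot> s = s"
    using Comp_Plus_left[OF s n sg] ns Comp_Ident_left[OF s] Comp_assoc[OF s r f] fr by simp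
  moreover have "(s \<cdot> g) \<cdot> s = s"
    using Comp_assoc[OF s g s] gs Comp_Ident_right[OF s] by simp
  ultimately have "f \<cdot> (r \<cdot> s) = Null C Z Y"
    using Plus_eq_right_imp_Null[OF Comp_Hom[OF rs f] s] by simp
  then have "f \<cdot> (r \<cdot> s) = f \<cdot> Null C Z X" using Comp_Null_right[OF f Z] by simp
  then have 2: "r \<cdot> s = Null C Z X" using kernel_mono[OF ker f rs Null_Hom[OF Z X]] by blast
  have "biproduct C X Z Y f s r g"
    unfolding biproduct_def using f g s r 1 2 gf gs fr ns Y by simp
  then show ?thesis
    using HomD[OF f] HomD[OF g] by (auto simp: splits_def)
qed

text \<open>Along the two decompositions, \<open>h\<close> is the identity matrix. Only one
  composite is computed; exchanging the biproducts gives the other.\<close>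

lemma biproduct_comparison:
  assumes "biproduct C X Z Y f s r g" and "biproduct C X Z Y' f' s' r' g'"
  defines "h \<equiv> f' \<cdot> r \<boxplus> s' \<cdot> g" and "h' \<equiv> f \<cdot> r' \<boxplus> s \<cdot> g'"
  shows "h \<in> Hom C Y Y'" "h \<cdot> f = f'" "g' \<cdot> h = g" "h' \<cdot> h = Ident C Y"
proof -
  have f: "f \<in> Hom C X Y" and s: "s \<in> Hom C Z Y" and r: "r \<in> Hom C Y X" and g: "g \<in> Hom C Y Z"
    and rf: "r \<cdot> f = Ident C X" and gs: "g \<cdot> s = Ident C Z" and gf: "g \<cdot> f = Null C X Z"
    and rs: "r \<cdot> s = Null C Z X" and id: "f \<cdot> r \<boxplus> s \<cdot> g = Ident C Y"
    using assms(1) by (auto simp: biproduct_def)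
  have f': "f' \<in> Hom C X Y'" and s': "s' \<in> Hom C Z Y'" and r': "r' \<in> Hom C Y' X"
    and g': "g' \<in> Hom C Y' Z"
    and rf': "r' \<cdot> f' = Ident C X" and gs': "g' \<cdot> s' = Ident C Z" and gf': "g' \<cdot> f' = Null C X Z"
    and rs': "r' \<cdot> s' = Null C Z X"
    using assms(2) by (auto simp: biproduct_def)
  note X = HomD(4)[OF f] and Y = HomD(5)[OF f] and Z = HomD(4)[OF s] and Y' = HomD(5)[OF f']
  have fr: "f' \<cdot> r \<in> Hom C Y Y'" and sg: "s' \<cdot> g \<in> Hom C Y Y'"
    and fr': "f \<cdot> r' \<in> Hom C Y' Y" and sg': "s \<cdot> g' \<in> Hom C Y' Y"
    using Comp_Hom f' s' r g f s r' g' by blast+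
  show h: "h \<in> Hom C Y Y'" using Plus_Hom[OF fr sg] by (simp add: h_def)
  have "h \<cdot> f = f' \<cdot> (r \<cdot> f) \<boxplus> s' \<cdot> (g \<cdot> f)"
    unfolding h_def using Comp_Plus_left[OF f fr sg] Comp_assoc[OF f r f'] Comp_assoc[OF f g s'] by simp
  then show "h \<cdot> f = f'"
    using rf gf Comp_Ident_right[OF f'] Comp_Null_right[OF s' X] Plus_Null_right[OF f'] by simp
  have "g' \<cdot> h = (g' \<cdot> f') \<cdot> r \<boxplus> (g' \<cdot> s') \<cdot> g"
    unfolding h_def using Comp_Plus_right[OF fr sg g'] Comp_assoc[OF r f' g'] Comp_assoc[OF g s' g'] by simp
  then show gh: "g' \<cdot> h = g"
    using gs' gf' Comp_Ident_left[OF g] Comp_Null_left[OF r Z] Plus_Null_left[OF g] by simp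
  have "r' \<cdot> h = (r' \<cdot> f') \<cdot> r \<boxplus> (r' \<cdot> s') \<cdot> g"
    unfolding h_def using Comp_Plus_right[OF fr sg r'] Comp_assoc[OF r f' r'] Comp_assoc[OF g s' r'] by simp
  then have rh: "r' \<cdot> h = r"
    using rs' rf' Comp_Ident_left[OF r] Comp_Null_left[OF g X] Plus_Null_right[OF r] by simp
  have "h' \<cdot> h = f \<cdot> (r' \<cdot> h) \<boxplus> s \<cdot> (g' \<cdot> h)"
    unfolding h'_def using Comp_Plus_left[OF h fr' sg'] Comp_assoc[OF h r' f] Comp_assoc[OF h g' s] by simp
  then show "h' \<cdot> h = Ident C Y" using rh gh id by simp
qed

lemma splits_equivalent:
  assumes "splits C f g" "splits C f' g'"
    and "Dom C f = Dom C f'" "Cod C g = Cod C g'"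
  shows "\<exists>h. iso_arrow C h (Cod C f) (Cod C f') \<and> h \<cdot> f = f' \<and> g' \<cdot> h = g"
proof -
  obtain r s where b: "biproduct C (Dom C f) (Cod C g) (Cod C f) f s r g"
    using assms(1) by (auto simp: splits_def)
  obtain r' s' where b': "biproduct C (Dom C f) (Cod C g) (Cod C f') f' s' r' g'"
    using assms(2-) by (auto simp: splits_def)
  show ?thesis
    using biproduct_comparison[OF b b'] biproduct_comparison[OF b' b]
    unfolding iso_arrow_def by blast
qed

text \<open>Reversing arrows also reverses the direction of an isomorphism of pairs, so closure
  under isomorphism dualizes by way of this symmetry.\<close>

lemma iso_pairs_sym:
  assumes "iso_pairs C (f, g) (f', g')"
  shows "iso_pairs C (f', g') (f, g)"
proof -
  have ar: "f \<in> Arr C" "g \<in> Arr C" "Cod C f = Dom C g" "f' \<in> Arr C" "g' \<in> Arr C" "Cod C f' = Dom C g'"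
    using assms by (auto simp: iso_pairs_def)
  have f: "f \<in> Hom C (Dom C f) (Dom C g)" and g: "g \<in> Hom C (Dom C g) (Cod C g)"
    and f': "f' \<in> Hom C (Dom C f') (Dom C g')" and g': "g' \<in> Hom C (Dom C g') (Cod C g')"
    using ar Arr_Hom by metis+
  \<comment> \<open>Inverts the vertical sides of a commuting square; applied to both squares of the
    isomorphism.\<close>
  have transpose: "b' \<cdot> p' = p \<cdot> a'"
    if p: "p \<in> Hom C X Y" "p' \<in> Hom C X' Y'" and a: "a \<in> Hom C X X'" "a' \<in> Hom C X' X" "a \<cdot> a' = Ident C X'"
      and b: "b \<in> Hom C Y Y'" "b' \<in> Hom C Y' Y" "b' \<cdot> b = Ident C Y" and eq: "b \<cdot> p = p' \<cdot> a"
    for a a' b b' p p' X Y X' Y'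
  proof -
    have "b' \<cdot> p' = b' \<cdot> (p' \<cdot> (a \<cdot> a'))" using a(3) Comp_Ident_right[OF p(2)] by simp
    also have "\<dots> = b' \<cdot> ((b \<cdot> p) \<cdot> a')" using Comp_assoc[OF a(2,1) p(2)] eq by simp
    also have "\<dots> = (b' \<cdot> b) \<cdot> (p \<cdot> a')"
      using Comp_assoc[OF a(2) p(1) b(1)] Comp_assoc[OF Comp_Hom[OF a(2) p(1)] b(1,2)] by simp
    finally show ?thesis using b(3) Comp_Ident_left[OF Comp_Hom[OF a(2) p(1)]] by simp
  qed
  obtain a b c a' b' c' where
    a: "a \<in> Hom C (Dom C f) (Dom C f')" "a' \<in> Hom C (Dom C f') (Dom C f)"
      "a' \<cdot> a = Ident C (Dom C f)" "a \<cdot> a' = Ident C (Dom C f')"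
    and b: "b \<in> Hom C (Dom C g) (Dom C g')" "b' \<in> Hom C (Dom C g') (Dom C g)"
      "b' \<cdot> b = Ident C (Dom C g)" "b \<cdot> b' = Ident C (Dom C g')"
    and c: "c \<in> Hom C (Cod C g) (Cod C g')" "c' \<in> Hom C (Cod C g') (Cod C g)"
      "c' \<cdot> c = Ident C (Cod C g)" "c \<cdot> c' = Ident C (Cod C g')"
    and eq: "b \<cdot> f = f' \<cdot> a" "c \<cdot> g = g' \<cdot> b"
    using assms unfolding iso_pairs_def iso_arrow_def by auto
  have "b' \<cdot> f' = f \<cdot> a'" by (rule transpose[OF f f' a(1,2,4) b(1-3) eq(1)])
  moreover have "c' \<cdot> g' = g \<cdot> b'" by (rule transpose[OF g g' b(1,2,4) c(1-3) eq(2)])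
  ultimately show ?thesis
    unfolding iso_pairs_def iso_arrow_def using a b c ar by auto
qed

end


section \<open>Duality\<close>

text \<open>Conflations are stored as pairs of arrows and reversal exchanges the two, so the class
  corresponding to \<open>E\<close> in \<open>opp C\<close> is the converse relation
  \<open>E\<inverse>\<close>.\<close>

definition opp :: "('o, 'm) precategory \<Rightarrow> ('o, 'm) precategory" where
  "opp C = \<lparr>Obj = Obj C, Arr = Arr C, Dom = Cod C, Cod = Dom C, Ident = Ident C,
     Comp = (\<lambda>g f. f \<cdot>\<^bsub>C\<^esub> g), Plus = Plus C, Null = (\<lambda>X Y. Null C Y X)\<rparr>"

lemma opp_simps [simp]:
  "Obj (opp C) = Obj C" "Arr (opp C) = Arr C" "Dom (opp C) = Cod C" "Cod (opp C) = Dom C"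
  "Ident (opp C) = Ident C" "g \<cdot>\<^bsub>opp C\<^esub> f = f \<cdot>\<^bsub>C\<^esub> g" "Plus (opp C) = Plus C"
  "Null (opp C) X Y = Null C Y X"
  by (simp_all add: opp_def)

lemma opp_opp [simp]: "opp (opp C) = C"
  by (simp add: opp_def)

lemma Hom_opp [simp]: "Hom (opp C) X Y = Hom C Y X"
  by (auto simp: Hom_def)

lemma Hom_group_opp [simp]: "Hom_group (opp C) X Y = Hom_group C Y X"
  by (simp add: Hom_group_def)

lemma iso_arrow_opp [simp]: "iso_arrow (opp C) f X Y \<longleftrightarrow> iso_arrow C f Y X"
  by (auto simp: iso_arrow_def)

lemma kernel_cokernel_pair_opp [simp]:
  "kernel_cokernel_pair (opp C) g f \<longleftrightarrow> kernel_cokernel_pair C f g"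
  by (auto simp: kernel_cokernel_pair_def is_kernel_def is_cokernel_def)

lemma iso_pairs_opp: "iso_pairs (opp C) (g, f) (g', f') \<longleftrightarrow> iso_pairs C (f', g') (f, g)"
  unfolding iso_pairs_def by (auto 0 4 simp: eq_commute)

lemma is_pullback_opp [simp]: "is_pullback (opp C) f h f' h' \<longleftrightarrow> is_pushout C f h f' h'"
  unfolding is_pullback_def is_pushout_def opp_simps Hom_opp by metis

lemma is_pushout_opp [simp]: "is_pushout (opp C) f h f' h' \<longleftrightarrow> is_pullback C f h f' h'"
  using is_pullback_opp[of "opp C" f h f' h'] by simp

lemma inflations_converse [simp]: "inflations (E\<inverse>) = deflations E"
  by (force simp: inflations_def deflations_def)

lemma deflations_converse [simp]: "deflations (E\<inverse>) = inflations E"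
  by (force simp: inflations_def deflations_def)

text \<open>The middle object is read off as the codomain of the first arrow, and reversal changes
  which arrow is first. The hypothesis supplies \<open>Cod C f = Dom C g\<close>, so both readings
  agree.\<close>

lemma proj_generated_opp:
  assumes "\<And>f g. (f, g) \<in> D \<Longrightarrow> kernel_cokernel_pair C f g"
  shows "proj_generated (opp C) (D\<inverse>) \<M> = (inj_generated C D \<M>)\<inverse>"
proof -
  have "Cod C f = Dom C g" if "(f, g) \<in> D" for f g
    using assms[OF that] by (simp add: kernel_cokernel_pair_def is_kernel_def)
  then show ?thesis by (auto simp: proj_generated_def inj_generated_def)
qed

lemma Div_opp: "Div (opp C) (D\<inverse>) (E\<inverse>) = Flat C D E"
  by (simp add: Div_def Flat_def)

context additive_category
begin

lemma additive_category_opp: "additive_category (opp C)"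
proof (rule additive_category.intro)
  show "\<exists>Z. zero_object (opp C) Z"
    using zero_object_exists by (simp add: zero_object_def conj_commute)
  show "\<exists>P i j p q. biproduct (opp C) X Y P i j p q" if XY: "X \<in> Obj (opp C)" "Y \<in> Obj (opp C)" for X Y
  proof -
    obtain P i j p q where "biproduct C X Y P i j p q"
      using biproduct_exists[of X Y] XY by (metis opp_simps(1))
    then have "biproduct (opp C) X Y P p q i j" by (auto simp: biproduct_def)
    then show "\<exists>P i j p q. biproduct (opp C) X Y P i j p q" by blast
  qed
qed (simp_all add: Dom_Obj Cod_Obj Ident_Hom Comp_Hom Comp_assoc[symmetric] Comp_Ident_right Comp_Ident_left
      Hom_comm_group Comp_Plus_right Comp_Plus_left)

text \<open>In the opposite category \<open>Cod C g\<close> is the first summand, so the two terms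
  of the sum giving the identity change places.\<close>

lemma splits_opp_imp:
  assumes "splits C f g"
  shows "splits (opp C) g f"
proof -
  obtain r s where b: "biproduct C (Dom C f) (Cod C g) (Cod C f) f s r g"
    using assms by (auto simp: splits_def)
  then have "f \<cdot> r \<in> Hom C (Cod C f) (Cod C f)" "s \<cdot> g \<in> Hom C (Cod C f) (Cod C f)"
    and "Dom C g = Cod C f"
    using Comp_Hom HomD(2) unfolding biproduct_def by blast+
  then have "biproduct (opp C) (Cod C g) (Dom C f) (Dom C g) g r s f"
    using b Plus_comm[of "s \<cdot> g" _ _ "f \<cdot> r"] by (auto simp: biproduct_def)
  then show ?thesis by (auto simp: splits_def)
qed

lemma splits_opp: "splits (opp C) g f \<longleftrightarrow> splits C f g"
  using splits_opp_imp additive_category.splits_opp_imp[OF additive_category_opp, of g f] by auto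

lemma Proj_opp: "Proj (opp C) (E\<inverse>) = Inj C E"
  using splits_opp by (fastforce simp: Proj_def Inj_def)

end


section \<open>Conflation classes\<close>

text \<open>
  Closure of deflations under composition is dropped here because its dual is not among
  the axioms of an exact structure; what is left is self-dual.
\<close>

locale conflation_class = additive_category C for C :: "('o, 'm) precategory" (structure) +
  fixes E :: "('m \<times> 'm) set"
  assumes kernel_cokernel: "(f, g) \<in> E \<Longrightarrow> kernel_cokernel_pair C f g"
    and iso_closed: "\<lbrakk>c \<in> E; iso_pairs C c c'\<rbrakk> \<Longrightarrow> c' \<in> E"
    and nonempty: "E \<noteq> {}"
    and pullback_exists: "\<lbrakk>g \<in> deflations E; h \<in> Arr C; Cod C h = Cod C g\<rbrakk> \<Longrightarrow>
      \<exists>g' h'. is_pullback C g h g' h' \<and> g' \<in> deflations E"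
    and pushout_exists: "\<lbrakk>f \<in> inflations E; h \<in> Arr C; Dom C h = Dom C f\<rbrakk> \<Longrightarrow>
      \<exists>f' h'. is_pushout C f h f' h' \<and> f' \<in> inflations E"
begin

lemma inflationsE:
  assumes "f \<in> inflations E"
  obtains g where "(f, g) \<in> E"
  using assms by (auto simp: inflations_def)

lemma deflationsE:
  assumes "g \<in> deflations E"
  obtains f where "(f, g) \<in> E"
  using assms by (auto simp: deflations_def)

lemma conflationD:
  assumes "(f, g) \<in> E"
  shows "is_kernel C f g" "is_cokernel C g f" "f \<in> inflations E" "g \<in> deflations E"
    "f \<in> Hom C (Dom C f) (Dom C g)" "g \<in> Hom C (Dom C g) (Cod C g)" "Cod C f = Dom C g"
    "g \<cdot> f = Null C (Dom C f) (Cod C g)"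
proof -
  show "f \<in> inflations E" "g \<in> deflations E"
    unfolding inflations_def deflations_def using assms by force+
qed (use kernel_cokernel[OF assms] in
    \<open>simp_all add: kernel_cokernel_pair_def is_kernel_def Hom_def\<close>)

text \<open>The two existence axioms change places. Pushouts, orthogonals and injectively generated
  classes inherit along this route what is shown for pullbacks and projectively generated
  classes.\<close>

lemma conflation_class_opp: "conflation_class (opp C) (E\<inverse>)"
proof -
  interpret op: additive_category "opp C" by (rule additive_category_opp)
  show ?thesis
  proof
    show "kernel_cokernel_pair (opp C) f g" if "(f, g) \<in> E\<inverse>" for f g
      using that kernel_cokernel by simp
    show "c' \<in> E\<inverse>" if "c \<in> E\<inverse>" "iso_pairs (opp C) c c'" for c c'
      using that iso_closed iso_pairs_sym iso_pairs_opp[of C "fst c" "snd c" "fst c'" "snd c'"]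
      by (cases c, cases c') auto
    show "E\<inverse> \<noteq> {}" using nonempty by auto
  qed (use pullback_exists pushout_exists in auto)
qed

text \<open>A pullback has the same kernel. Some kernel \<open>j\<close> of \<open>g'\<close> comes
  with the deflation; its domain is isomorphic to \<open>Dom C f\<close>, and closure under
  isomorphism lets \<open>j\<close> be replaced by an arrow starting at \<open>Dom C f\<close>
  itself.\<close>

lemma pullback_conflation:
  assumes fg: "(f, g) \<in> E" and pb: "is_pullback C g h g' h'" and g'E: "g' \<in> deflations E"
  shows "\<exists>i. (i, g') \<in> E \<and> i \<in> Hom C (Dom C f) (Dom C g') \<and> h' \<cdot> i = f"
proof -
  note f = conflationD(5)[OF fg] and g = conflationD(6)[OF fg]
  have h: "h \<in> Hom C (Dom C h) (Cod C g)" and g': "g' \<in> Hom C (Dom C g') (Dom C h)"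
    and h': "h' \<in> Hom C (Dom C g') (Dom C g)" and sq: "g \<cdot> h' = h \<cdot> g'"
    using pb by (auto simp: is_pullback_def Hom_def)
  note X = HomD(4)[OF f]
  note P = HomD(4)[OF g'] and W = HomD(5)[OF g']
  obtain j where jE: "(j, g') \<in> E" using g'E by (rule deflationsE)
  note j = conflationD(5)[OF jE]
  note K = HomD(4)[OF j]
  \<comment> \<open>The pair (f, 0) is compatible with the square and induces \<open>i\<close>;
    \<open>b\<close> and \<open>a\<close> are then the two comparisons between the kernel
    objects.\<close>
  have "g \<cdot> f = h \<cdot> Null C (Dom C f) (Dom C h)"
    using conflationD(8)[OF fg] Comp_Null_right[OF h X] by simp
  then obtain i where i: "i \<in> Hom C (Dom C f) (Dom C g')" and h'i: "h' \<cdot> i = f"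
      and g'i: "g' \<cdot> i = Null C (Dom C f) (Dom C h)"
    using pullback_lift[OF pb f Null_Hom[OF X W]] by blast
  obtain b where b: "b \<in> Hom C (Dom C f) (Dom C j)" and jb: "j \<cdot> b = i"
    using kernel_lift[OF conflationD(1)[OF jE] j g' i g'i] by blast
  have h'j: "h' \<cdot> j \<in> Hom C (Dom C j) (Dom C g)" by (rule Comp_Hom[OF j h'])
  have g'j: "g' \<cdot> j = Null C (Dom C j) (Dom C h)"
    using conflationD(8)[OF jE] HomD[OF g'] by simp
  have gh'j: "g \<cdot> (h' \<cdot> j) = h \<cdot> (g' \<cdot> j)"
    using Comp_assoc[OF j h' g] Comp_assoc[OF j g' h] sq by simp
  then have "g \<cdot> (h' \<cdot> j) = Null C (Dom C j) (Cod C g)"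
    using g'j Comp_Null_right[OF h K] by simp
  then obtain a where a: "a \<in> Hom C (Dom C j) (Dom C f)" and fa: "f \<cdot> a = h' \<cdot> j"
    using kernel_lift[OF conflationD(1)[OF fg] f g h'j] by blast
  have ia: "i \<cdot> a \<in> Hom C (Dom C j) (Dom C g')" by (rule Comp_Hom[OF a i])
  have "h' \<cdot> (i \<cdot> a) = h' \<cdot> j" using Comp_assoc[OF a i h'] h'i fa by simp
  moreover have "g' \<cdot> (i \<cdot> a) = g' \<cdot> j"
    using Comp_assoc[OF a i g'] g'i g'j Comp_Null_left[OF a W] by simp
  ultimately have ia_eq: "i \<cdot> a = j"
    using pb K h'j Comp_Hom[OF j g'] gh'j ia j unfolding is_pullback_def by blast
  have "j \<cdot> (b \<cdot> a) = j \<cdot> Ident C (Dom C j)"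
    using Comp_assoc[OF a b j] jb ia_eq Comp_Ident_right[OF j] by simp
  then have ba: "b \<cdot> a = Ident C (Dom C j)"
    using kernel_mono[OF conflationD(1)[OF jE] j Comp_Hom[OF a b] Ident_Hom[OF K]] by simp
  have "f \<cdot> (a \<cdot> b) = f \<cdot> Ident C (Dom C f)"
    using Comp_assoc[OF b a f] fa Comp_assoc[OF b j h'] jb h'i Comp_Ident_right[OF f] by simp
  then have ab: "a \<cdot> b = Ident C (Dom C f)"
    using kernel_mono[OF conflationD(1)[OF fg] f Comp_Hom[OF b a] Ident_Hom[OF X]] by simp
  have "iso_arrow C a (Dom C j) (Dom C i)"
    unfolding iso_arrow_def using a b ab ba HomD[OF i] by auto
  then have "iso_pairs C (j, g') (i, g')"
    using HomD[OF i] HomD[OF j] HomD[OF g'] iso_arrow_Ident[OF P] iso_arrow_Ident[OF W]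
      Comp_Ident_left[OF j] Comp_Ident_left[OF g'] Comp_Ident_right[OF g'] ia_eq
    unfolding iso_pairs_def split_conv
    by (intro conjI, simp_all)
      (rule exI[of _ a], simp, rule exI[of _ "Ident C (Dom C g')"], simp,
        rule exI[of _ "Ident C (Dom C h)"], simp)
  then show ?thesis using iso_closed[OF jE] i h'i by blast
qed

lemma pullback_along:
  assumes fg: "(f, g) \<in> E" and h: "h \<in> Hom C W (Cod C g)"
  obtains P i g' h' where "(i, g') \<in> E" "i \<in> Hom C (Dom C f) P" "g' \<in> Hom C P W"
    "h' \<in> Hom C P (Dom C g)" "h' \<cdot> i = f" "is_pullback C g h g' h'"
proof -
  obtain g' h' where pb: "is_pullback C g h g' h'" and g'E: "g' \<in> deflations E"
    using pullback_exists conflationD(4)[OF fg] HomD[OF h] by metis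
  obtain i where i: "(i, g') \<in> E" "i \<in> Hom C (Dom C f) (Dom C g')" "h' \<cdot> i = f"
    using pullback_conflation[OF fg pb g'E] by blast
  have "g' \<in> Hom C (Dom C g') W" "h' \<in> Hom C (Dom C g') (Dom C g)"
    using pb HomD[OF h] by (auto simp: is_pullback_def Hom_def)
  then show thesis using that i pb by blast
qed

lemma pushout_along:
  assumes fg: "(f, g) \<in> E" and h: "h \<in> Hom C (Dom C f) W"
  obtains P f' k h' where "(f', k) \<in> E" "f' \<in> Hom C W P" "k \<in> Hom C P (Cod C g)"
    "h' \<in> Hom C (Cod C f) P" "k \<cdot> h' = g" "is_pushout C f h f' h'"
proof -
  interpret op: conflation_class "opp C" "E\<inverse>" by (rule conflation_class_opp)
  show thesis by (rule op.pullback_along[of g f h W]) (use fg h that in auto)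
qed

text \<open>A pushout along a zero arrow, followed by a pullback along a zero arrow, splits.\<close>

lemma split_conflation_exists:
  assumes X: "X \<in> Obj C" and Z: "Z \<in> Obj C"
  shows "\<exists>(f, g) \<in> E. Dom C f = X \<and> Cod C g = Z \<and> splits C f g"
proof -
  obtain f0 g0 where fg0: "(f0, g0) \<in> E" using nonempty by auto
  have "Null C (Dom C f0) X \<in> Hom C (Dom C f0) X"
    using HomD[OF conflationD(5)[OF fg0]] X Null_Hom by simp
  then obtain Q f1 g1 where fg1: "(f1, g1) \<in> E" and f1: "f1 \<in> Hom C X Q"
    using pushout_along[OF fg0] by metis
  note g1 = conflationD(6)[OF fg1]
  note Q = HomD(4)[OF g1] and Z1 = HomD(5)[OF g1]
  obtain P f g h where fg: "(f, g) \<in> E" and f: "f \<in> Hom C X P" and g: "g \<in> Hom C P Z"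
    and pb: "is_pullback C g1 (Null C Z (Cod C g1)) g h"
    using pullback_along[OF fg1 Null_Hom[OF Z Z1]] HomD[OF f1] by metis
  \<comment> \<open>Over a zero arrow the pair (0, 1) is compatible with the square, and what it
    induces is a section of \<open>g\<close>.\<close>
  have "g1 \<cdot> Null C Z (Dom C g1) = Null C Z (Cod C g1) \<cdot> Ident C Z"
    using Comp_Null_right[OF g1 Z] Comp_Ident_right[OF Null_Hom[OF Z Z1]] by simp
  then obtain s where "s \<in> Hom C Z (Dom C g)" "g \<cdot> s = Ident C Z"
    using pullback_lift[OF pb Null_Hom[OF Z Q]] Ident_Hom[OF Z] HomD[OF Null_Hom[OF Z Z1]] by metis
  then have "splits C f g"
    using section_split[OF kernel_cokernel[OF fg] f g] HomD[OF g] by blast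
  then show ?thesis using fg HomD[OF f] HomD[OF g] by blast
qed

text \<open>Forwards, a conflation lies in its own class, which can only be the zero class.
  Backwards, split conflations with the same ends are all equivalent, so there is at most one
  class.\<close>

lemma Ext1_vanishes_iff:
  assumes X: "X \<in> Obj C" and Z: "Z \<in> Obj C"
  shows "Ext1_vanishes C E Z X \<longleftrightarrow> (\<forall>f g. (f, g) \<in> E \<and> Dom C f = X \<and> Cod C g = Z \<longrightarrow> splits C f g)"
proof
  assume van: "Ext1_vanishes C E Z X"
  show "\<forall>f g. (f, g) \<in> E \<and> Dom C f = X \<and> Cod C g = Z \<longrightarrow> splits C f g"
  proof safe
    fix f g assume fg: "(f, g) \<in> E" and "X = Dom C f" "Z = Cod C g"
    then have cb: "(f, g) \<in> conflations_between C E X Z" by (simp add: conflations_between_def)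
    note f = conflationD(5)[OF fg] and g = conflationD(6)[OF fg]
    have "iso_arrow C (Ident C (Dom C g)) (Cod C f) (Cod C f)"
      using iso_arrow_Ident[OF HomD(5)[OF f]] HomD[OF f] by simp
    then have "((f, g), (f, g)) \<in> Yoneda_equiv C E X Z"
      using cb Comp_Ident_left[OF f] Comp_Ident_right[OF g] by (auto simp: Yoneda_equiv_def)
    moreover have "Yoneda_equiv C E X Z `` {(f, g)} \<in> Ext1 C E Z X"
      using cb by (auto simp: Ext1_def quotient_def)
    ultimately have "(f, g) \<in> Ext1_zero C E Z X"
      using van by (auto simp: Ext1_vanishes_def)
    then show "splits C f g" by (simp add: Ext1_zero_def)
  qed
next
  assume split: "\<forall>f g. (f, g) \<in> E \<and> Dom C f = X \<and> Cod C g = Z \<longrightarrow> splits C f g"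
  let ?A = "conflations_between C E X Z"
  have A: "Ext1_zero C E Z X = ?A"
    using split by (auto simp: Ext1_zero_def conflations_between_def)
  have "((f, g), (f', g')) \<in> Yoneda_equiv C E X Z" if "(f, g) \<in> ?A" "(f', g') \<in> ?A" for f g f' g'
  proof -
    have "splits C f g" "splits C f' g'" "Dom C f = Dom C f'" "Cod C g = Cod C g'"
      using that split by (auto simp: conflations_between_def)
    then show ?thesis using that splits_equivalent by (simp add: Yoneda_equiv_def)
  qed
  then have "Yoneda_equiv C E X Z `` {c} = ?A" if "c \<in> ?A" for c
    using that by (auto simp: Yoneda_equiv_def)
  \<comment> \<open>With no conflations the quotient would be empty rather than a singleton.\<close>
  moreover have "?A \<noteq> {}"
    using split_conflation_exists[OF X Z] by (auto simp: conflations_between_def)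
  ultimately show "Ext1_vanishes C E Z X"
    unfolding Ext1_vanishes_def A Ext1_def quotient_def by auto
qed

section \<open>Orthogonal classes under duality\<close>

lemma Ext1_vanishes_opp:
  assumes "X \<in> Obj C" and "Z \<in> Obj C"
  shows "Ext1_vanishes (opp C) (E\<inverse>) X Z \<longleftrightarrow> Ext1_vanishes C E Z X"
  using conflation_class.Ext1_vanishes_iff[OF conflation_class_opp, of Z X] assms
    Ext1_vanishes_iff splits_opp by auto

lemma right_perp_opp: "\<A> \<subseteq> Obj C \<Longrightarrow> right_perp (opp C) (E\<inverse>) \<A> = left_perp C E \<A>"
  using Ext1_vanishes_opp by (auto simp: right_perp_def left_perp_def)

lemma left_perp_opp: "\<A> \<subseteq> Obj C \<Longrightarrow> left_perp (opp C) (E\<inverse>) \<A> = right_perp C E \<A>"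
  using Ext1_vanishes_opp by (auto simp: right_perp_def left_perp_def)

lemma cotorsion_pairs_opp: "cotorsion_pairs (opp C) (E\<inverse>) = (cotorsion_pairs C E)\<inverse>"
  by (auto simp: cotorsion_pairs_def right_perp_opp left_perp_opp)

text \<open>Since \<open>f\<close> is a kernel of \<open>g\<close>, Hom(M, -) is left exact on the
  conflation; only surjectivity at the right end has content.\<close>

lemma short_exact_Hom_iff:
  assumes fg: "(f, g) \<in> E" and M: "M \<in> Obj C"
  shows "short_exact_sequence (Hom_group C M (Cod C g)) (Hom_group C M (Cod C f))
      (Hom_group C M (Dom C f)) (\<lambda>u. g \<cdot> u) (\<lambda>u. f \<cdot> u) \<longleftrightarrow>
    (\<forall>u \<in> Hom C M (Cod C g). \<exists>v \<in> Hom C M (Dom C g). g \<cdot> v = u)"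
proof -
  note f = conflationD(5)[OF fg] and g = conflationD(6)[OF fg]
  note X = HomD(4)[OF f] and Y = HomD(5)[OF f] and Z = HomD(5)[OF g]
  have gr: "group (Hom_group C M (Dom C f))" "group (Hom_group C M (Dom C g))"
    "group (Hom_group C M (Cod C g))"
    using Hom_comm_group M X Y Z by (auto intro: comm_group.axioms(2))
  have hf: "(\<lambda>u. f \<cdot> u) \<in> hom (Hom_group C M (Dom C f)) (Hom_group C M (Dom C g))"
    and hg: "(\<lambda>u. g \<cdot> u) \<in> hom (Hom_group C M (Dom C g)) (Hom_group C M (Cod C g))"
    using Comp_Hom f g Comp_Plus_right[OF _ _ f] Comp_Plus_right[OF _ _ g]
    by (auto simp: hom_def Hom_group_def)
  have inj: "inj_on (\<lambda>u. f \<cdot> u) (Hom C M (Dom C f))"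
    using kernel_mono[OF conflationD(1)[OF fg] f] by (auto intro: inj_onI)
  have "g \<cdot> (f \<cdot> u) = Null C M (Cod C g)" if "u \<in> Hom C M (Dom C f)" for u
    using Comp_assoc[OF that f g] conflationD(8)[OF fg] Comp_Null_left[OF that Z] by simp
  then have ker: "kernel (Hom_group C M (Dom C g)) (Hom_group C M (Cod C g)) (\<lambda>u. g \<cdot> u) =
      (\<lambda>u. f \<cdot> u) ` Hom C M (Dom C f)"
    using kernel_lift[OF conflationD(1)[OF fg] f g] Comp_Hom[OF _ f]
    by (auto simp: kernel_def Hom_group_def) blast
  have "(\<forall>u \<in> Hom C M (Cod C g). \<exists>v \<in> Hom C M (Dom C g). g \<cdot> v = u) \<longleftrightarrow>
      (\<lambda>u. g \<cdot> u) ` Hom C M (Dom C g) = Hom C M (Cod C g)"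
    using Comp_Hom[OF _ g] by (simp add: set_eq_iff image_iff) metis
  then show ?thesis
    unfolding short_exact_sequence_iff
    using gr hf hg inj ker HomD(3)[OF f]
    by (auto simp: epi_def mon_def Hom_group_def group_hom_def group_hom_axioms_def)
qed

section \<open>Membership in a projectively generated class\<close>

lemma proj_generated_iff:
  assumes "\<M> \<subseteq> Obj C"
  shows "(f, g) \<in> proj_generated C E \<M> \<longleftrightarrow> (f, g) \<in> E \<and>
    (\<forall>M \<in> \<M>. \<forall>u \<in> Hom C M (Cod C g). \<exists>v \<in> Hom C M (Dom C g). g \<cdot> v = u)"
proof (cases "(f, g) \<in> E")
  case True
  then have "short_exact_sequence (Hom_group C M (Cod C g)) (Hom_group C M (Cod C f))
      (Hom_group C M (Dom C f)) (\<lambda>u. g \<cdot> u) (\<lambda>u. f \<cdot> u) \<longleftrightarrow>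
      (\<forall>u \<in> Hom C M (Cod C g). \<exists>v \<in> Hom C M (Dom C g). g \<cdot> v = u)" if "M \<in> \<M>" for M
    using short_exact_Hom_iff assms that by blast
  then show ?thesis using True by (simp add: proj_generated_def)
qed (auto simp: proj_generated_def)

lemma proj_generatedI:
  assumes "\<M> \<subseteq> Obj C" and "(f, g) \<in> E"
    and "\<And>M u. \<lbrakk>M \<in> \<M>; u \<in> Hom C M (Cod C g)\<rbrakk> \<Longrightarrow> \<exists>v \<in> Hom C M (Dom C g). g \<cdot> v = u"
  shows "(f, g) \<in> proj_generated C E \<M>"
  using assms proj_generated_iff by blast

lemma proj_generated_lift:
  assumes "\<M> \<subseteq> Obj C" and "(f, g) \<in> proj_generated C E \<M>" and "M \<in> \<M>" and "u \<in> Hom C M (Cod C g)"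
  shows "\<exists>v \<in> Hom C M (Dom C g). g \<cdot> v = u"
  using assms proj_generated_iff by blast

lemma proj_generated_subset: "proj_generated C E \<M> \<subseteq> E"
  by (auto simp: proj_generated_def)

text \<open>Bridges \<open>Div\<close>, which speaks of inflations, and the lifting condition, which
  speaks of deflations: two cokernels of \<open>f\<close> differ by an isomorphism, and lifts
  transfer along it.\<close>

lemma proj_generated_same_inflation:
  assumes M: "\<M> \<subseteq> Obj C" and "f \<in> inflations (proj_generated C E \<M>)" and fg: "(f, g) \<in> E"
  shows "(f, g) \<in> proj_generated C E \<M>"
proof (rule proj_generatedI[OF M fg])
  obtain g' where g'gen: "(f, g') \<in> proj_generated C E \<M>" using assms by (auto simp: inflations_def)
  then have fg': "(f, g') \<in> E" using proj_generated_subset by blast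
  note f = conflationD(5)[OF fg] and g = conflationD(6)[OF fg]
  have dom: "Dom C g' = Dom C g" using conflationD(7)[OF fg] conflationD(7)[OF fg'] by simp
  then have g': "g' \<in> Hom C (Dom C g) (Cod C g')" using conflationD(6)[OF fg'] by simp
  have "g' \<cdot> f = Null C (Dom C f) (Cod C g')" by (rule conflationD(8)[OF fg'])
  then obtain d where d: "d \<in> Hom C (Cod C g) (Cod C g')" and dg: "d \<cdot> g = g'"
    using cokernel_factor[OF conflationD(2)[OF fg] f g g'] by blast
  obtain c where c: "c \<in> Hom C (Cod C g') (Cod C g)" and cg: "c \<cdot> g' = g"
    using cokernel_factor[OF conflationD(2)[OF fg'] f g' g] conflationD(8)[OF fg] by blast
  have "\<exists>!k. k \<in> Hom C (Cod C g) (Cod C g) \<and> k \<cdot> g = g"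
    using conflationD(2,8)[OF fg] g HomD[OF g] conflationD(7)[OF fg] unfolding is_cokernel_def by simp
  moreover have "(c \<cdot> d) \<cdot> g = g" using Comp_assoc[OF g d c] dg cg by simp
  ultimately have cd: "c \<cdot> d = Ident C (Cod C g)"
    using Comp_Hom[OF d c] Ident_Hom[OF HomD(5)[OF g]] Comp_Ident_left[OF g] by blast
  fix M u assume "M \<in> \<M>" and u: "u \<in> Hom C M (Cod C g)"
  then obtain v where v: "v \<in> Hom C M (Dom C g)" and "g' \<cdot> v = d \<cdot> u"
    using proj_generated_lift[OF M g'gen] Comp_Hom[OF u d] dom by metis
  then have "g \<cdot> v = u"
    using Comp_assoc[OF v g' c] Comp_assoc[OF u d c] cg cd Comp_Ident_left[OF u] by simp
  then show "\<exists>v \<in> Hom C M (Dom C g). g \<cdot> v = u" using v by blast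
qed

text \<open>A lift of \<open>h \<cdot> u\<close> through \<open>g\<close> and the arrow
  \<open>u\<close> itself together induce an arrow into the pullback.\<close>

lemma proj_generated_pullback:
  assumes M: "\<M> \<subseteq> Obj C" and fg: "(f, g) \<in> proj_generated C E \<M>"
    and ig: "(i, g') \<in> E" and pb: "is_pullback C g h g' h'"
  shows "(i, g') \<in> proj_generated C E \<M>"
proof (rule proj_generatedI[OF M ig])
  fix M u assume MM: "M \<in> \<M>" and u: "u \<in> Hom C M (Cod C g')"
  have h: "h \<in> Hom C (Cod C g') (Cod C g)" using pb by (auto simp: is_pullback_def Hom_def)
  obtain v where v: "v \<in> Hom C M (Dom C g)" "g \<cdot> v = h \<cdot> u"
    using proj_generated_lift[OF M fg MM Comp_Hom[OF u h]] by blast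
  then show "\<exists>w \<in> Hom C M (Dom C g'). g' \<cdot> w = u"
    using pullback_lift[OF pb v(1), of u] u HomD(2)[OF h] by auto
qed

lemma conflation_class_proj_generated:
  assumes M: "\<M> \<subseteq> Obj C"
  shows "conflation_class C (proj_generated C E \<M>)"
proof
  let ?G = "proj_generated C E \<M>"
  show "kernel_cokernel_pair C f g" if "(f, g) \<in> ?G" for f g
    using that proj_generated_subset kernel_cokernel by blast
  show "c' \<in> ?G" if c: "c \<in> ?G" and iso: "iso_pairs C c c'" for c c'
  proof -
    obtain f g f' g' where cc: "c = (f, g)" "c' = (f', g')" by (cases c, cases c')
    have fg: "(f, g) \<in> ?G" using c cc by simp
    have c'E: "(f', g') \<in> E" using iso_closed c iso cc proj_generated_subset by blast
    have fgE: "(f, g) \<in> E" using fg proj_generated_subset by blast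
    note g = conflationD(6)[OF fgE] and g' = conflationD(6)[OF c'E]
    obtain b z z' where b: "b \<in> Hom C (Dom C g) (Dom C g')"
      and z: "z \<in> Hom C (Cod C g) (Cod C g')" "z' \<in> Hom C (Cod C g') (Cod C g)"
      "z \<cdot> z' = Ident C (Cod C g')" and eq: "z \<cdot> g = g' \<cdot> b"
      using iso cc conflationD(7)[OF fgE] conflationD(7)[OF c'E]
      by (auto simp: iso_pairs_def iso_arrow_def)
    \<comment> \<open>Move \<open>u\<close> back along \<open>z'\<close>, lift it there, and push
      the lift forward along \<open>b\<close>.\<close>
    have "\<exists>v \<in> Hom C M (Dom C g'). g' \<cdot> v = u" if MM: "M \<in> \<M>" and u: "u \<in> Hom C M (Cod C g')" for M u
    proof -
      obtain v where v: "v \<in> Hom C M (Dom C g)" "g \<cdot> v = z' \<cdot> u"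
        using proj_generated_lift[OF M fg MM Comp_Hom[OF u z(2)]] by blast
      have "g' \<cdot> (b \<cdot> v) = z \<cdot> (z' \<cdot> u)"
        using Comp_assoc[OF v(1) b g'] Comp_assoc[OF v(1) g z(1)] eq v(2) by simp
      also have "\<dots> = u" using Comp_assoc[OF u z(2,1)] z(3) Comp_Ident_left[OF u] by simp
      finally show ?thesis using Comp_Hom[OF v(1) b] by blast
    qed
    then show ?thesis using proj_generatedI[OF M c'E] cc by blast
  qed
  \<comment> \<open>A split conflation belongs to every generated class: with a section
    \<open>s\<close>, the arrow \<open>u\<close> lifts to \<open>s \<cdot> u\<close>.\<close>
  obtain X where X: "X \<in> Obj C" using zero_object_exists by (auto simp: zero_object_def)
  then obtain f g where fg: "(f, g) \<in> E" and "splits C f g"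
    using split_conflation_exists[OF X X] by blast
  note g = conflationD(6)[OF fg]
  obtain s where s: "s \<in> Hom C (Cod C g) (Dom C g)" "g \<cdot> s = Ident C (Cod C g)"
    using split_section[OF \<open>splits C f g\<close> g] by blast
  have "\<exists>v \<in> Hom C M (Dom C g). g \<cdot> v = u" if u: "u \<in> Hom C M (Cod C g)" for M u
    using Comp_Hom[OF u s(1)] Comp_assoc[OF u s(1) g] s(2) Comp_Ident_left[OF u] by metis
  then have "(f, g) \<in> ?G" using proj_generatedI[OF M fg] by blast
  then show "?G \<noteq> {}" by blast
  show "\<exists>g' h'. is_pullback C g h g' h' \<and> g' \<in> deflations ?G"
    if g: "g \<in> deflations ?G" and h: "h \<in> Arr C" "Cod C h = Cod C g" for g h
  proof -
    obtain f where fg: "(f, g) \<in> ?G" using g by (auto simp: deflations_def)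
    then have "(f, g) \<in> E" and "h \<in> Hom C (Dom C h) (Cod C g)"
      using proj_generated_subset h by (auto simp: Hom_def)
    then obtain i g' h' where "(i, g') \<in> E" and pb: "is_pullback C g h g' h'"
      using pullback_along by metis
    then have "(i, g') \<in> ?G" using proj_generated_pullback[OF M fg] by blast
    then show ?thesis using pb by (force simp: deflations_def)
  qed
  show "\<exists>f' h'. is_pushout C f h f' h' \<and> f' \<in> inflations ?G"
    if f: "f \<in> inflations ?G" and h: "h \<in> Arr C" "Dom C h = Dom C f" for f h
  proof -
    obtain g where fg: "(f, g) \<in> ?G" using f by (auto simp: inflations_def)
    then have fgE: "(f, g) \<in> E" and "h \<in> Hom C (Dom C f) (Cod C h)"
      using proj_generated_subset h by (auto simp: Hom_def)
    then obtain P f' k h' where f'E: "(f', k) \<in> E" and k: "k \<in> Hom C P (Cod C g)"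
      and h': "h' \<in> Hom C (Cod C f) P" and kh': "k \<cdot> h' = g" and po: "is_pushout C f h f' h'"
      using pushout_along by metis
    \<comment> \<open>The pushout keeps the cokernel, \<open>k \<cdot> h' = g\<close>, so composing
      a lift through \<open>g\<close> with \<open>h'\<close> gives a lift through
      \<open>k\<close>.\<close>
    have "\<exists>v \<in> Hom C M (Dom C k). k \<cdot> v = u" if MM: "M \<in> \<M>" and u: "u \<in> Hom C M (Cod C k)" for M u
    proof -
      have "u \<in> Hom C M (Cod C g)" using u HomD[OF k] by simp
      then obtain v where v: "v \<in> Hom C M (Dom C g)" "g \<cdot> v = u"
        using proj_generated_lift[OF M fg MM] by blast
      then have "k \<cdot> (h' \<cdot> v) = u"
        using Comp_assoc[of v M "Dom C g" h' P k] h' k kh' conflationD(7)[OF fgE] by simp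
      then show ?thesis using Comp_Hom[OF v(1)] h' conflationD(7)[OF fgE] HomD[OF k] by auto
    qed
    then have "(f', k) \<in> ?G" using proj_generatedI[OF M f'E] by blast
    then show ?thesis using po by (force simp: inflations_def)
  qed
qed


section \<open>Cotorsion pairs and relative projectivity\<close>

text \<open>From divisibility to orthogonality, lift the identity of a member of
  \<open>\<M>\<close>. Conversely, pull back along each \<open>u\<close> and compose a section with
  the projection \<open>h'\<close>.\<close>

lemma Div_proj_generated:
  assumes M: "\<M> \<subseteq> Obj C"
  shows "Div C E (proj_generated C E \<M>) = right_perp C E \<M>"
proof (intro equalityI subsetI)
  fix X assume X: "X \<in> Div C E (proj_generated C E \<M>)"
  then have XO: "X \<in> Obj C" by (simp add: Div_def)
  have "Ext1_vanishes C E A X" if A: "A \<in> \<M>" for A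
  proof -
    have "splits C f g" if "(f, g) \<in> E" "Dom C f = X" "Cod C g = A" for f g
    proof -
      have "(f, g) \<in> proj_generated C E \<M>"
        using X that proj_generated_same_inflation[OF M] conflationD(3) by (simp add: Div_def)
      then have "\<exists>s \<in> Hom C A (Dom C g). g \<cdot> s = Ident C A"
        using proj_generated_lift[OF M _ A] Ident_Hom A M that by auto
      then show ?thesis
        using section_split[OF kernel_cokernel conflationD(5,6)] that by blast
    qed
    then show ?thesis using Ext1_vanishes_iff XO A M by blast
  qed
  then show "X \<in> right_perp C E \<M>" using XO by (simp add: right_perp_def)
next
  fix X assume X: "X \<in> right_perp C E \<M>"
  then have XO: "X \<in> Obj C" by (simp add: right_perp_def)
  have "f \<in> inflations (proj_generated C E \<M>)" if f: "f \<in> inflations E" "Dom C f = X" for f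
  proof -
    obtain g where fg: "(f, g) \<in> E" using f(1) by (rule inflationsE)
    note g = conflationD(6)[OF fg]
    have "\<exists>v \<in> Hom C M (Dom C g). g \<cdot> v = u" if MM: "M \<in> \<M>" and u: "u \<in> Hom C M (Cod C g)" for M u
    proof -
      obtain P i g' h' where ig: "(i, g') \<in> E" and i: "i \<in> Hom C (Dom C f) P"
        and g': "g' \<in> Hom C P M" and h': "h' \<in> Hom C P (Dom C g)" and pb: "is_pullback C g u g' h'"
        using pullback_along[OF fg u] by metis
      \<comment> \<open>The pulled-back conflation still starts at \<open>X\<close> and now ends in
        a member of \<open>\<M>\<close>.\<close>
      have "splits C i g'"
        using X MM M Ext1_vanishes_iff[OF XO, of M] ig HomD[OF i] HomD[OF g'] f(2)
        by (auto simp: right_perp_def)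
      then obtain s where s: "s \<in> Hom C M P" "g' \<cdot> s = Ident C M"
        using split_section[OF _ g'] by blast
      have "g \<cdot> (h' \<cdot> s) = (u \<cdot> g') \<cdot> s"
        using Comp_assoc[OF s(1) h' g] pb by (simp add: is_pullback_def)
      also have "\<dots> = u" using Comp_assoc[OF s(1) g' u] s(2) Comp_Ident_right[OF u] by simp
      finally show ?thesis using Comp_Hom[OF s(1) h'] by blast
    qed
    then have "(f, g) \<in> proj_generated C E \<M>" using proj_generatedI[OF M fg] by blast
    then show ?thesis by (force simp: inflations_def)
  qed
  then show "X \<in> Div C E (proj_generated C E \<M>)" using XO by (simp add: Div_def)
qed

lemma subset_Proj_proj_generated:
  assumes M: "\<M> \<subseteq> Obj C"
  shows "\<M> \<subseteq> Proj C (proj_generated C E \<M>)"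
proof
  fix P assume P: "P \<in> \<M>"
  have "splits C f g" if fg: "(f, g) \<in> proj_generated C E \<M>" "Cod C g = P" for f g
  proof -
    have "(f, g) \<in> E" using fg proj_generated_subset by blast
    then show ?thesis
      using section_split[OF kernel_cokernel conflationD(5,6)] proj_generated_lift[OF M fg(1) P]
        Ident_Hom[of P] fg(2) P M by blast
  qed
  then show "P \<in> Proj C (proj_generated C E \<M>)" using P M by (auto simp: Proj_def)
qed

text \<open>A conflation of \<open>E\<close> with divisible start already lies in the generated
  class, so it splits when its end is relatively projective.\<close>

lemma Proj_proj_generated_subset:
  assumes M: "\<M> \<subseteq> Obj C"
  shows "Proj C (proj_generated C E \<M>) \<subseteq> left_perp C E (Div C E (proj_generated C E \<M>))"
proof
  fix P assume P: "P \<in> Proj C (proj_generated C E \<M>)"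
  have "Ext1_vanishes C E P X" if X: "X \<in> Div C E (proj_generated C E \<M>)" for X
  proof -
    have "splits C f g" if fg: "(f, g) \<in> E" "Dom C f = X" "Cod C g = P" for f g
    proof -
      have "(f, g) \<in> proj_generated C E \<M>"
        using X fg conflationD(3) proj_generated_same_inflation[OF M] by (simp add: Div_def)
      then show ?thesis using P fg(3) by (auto simp: Proj_def)
    qed
    then show ?thesis using Ext1_vanishes_iff[of X P] X P by (auto simp: Div_def Proj_def)
  qed
  then show "P \<in> left_perp C E (Div C E (proj_generated C E \<M>))"
    using P by (simp add: Proj_def left_perp_def)
qed

text \<open>Enlarging the generating class can only shrink the structure. Nothing is lost, because
  pullbacks stay in the generated class and split as soon as they end in one of its
  projectives.\<close>

lemma proj_generated_Proj:
  assumes M: "\<M> \<subseteq> Obj C"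
  shows "proj_generated C E (Proj C (proj_generated C E \<M>)) = proj_generated C E \<M>"
proof
  let ?G = "proj_generated C E \<M>"
  have PO: "Proj C ?G \<subseteq> Obj C" by (auto simp: Proj_def)
  show "proj_generated C E (Proj C ?G) \<subseteq> ?G"
    using subset_Proj_proj_generated[OF M] by (auto simp: proj_generated_def)
  interpret G: conflation_class C ?G by (rule conflation_class_proj_generated[OF M])
  show "?G \<subseteq> proj_generated C E (Proj C ?G)"
  proof clarify
    fix f g assume fg: "(f, g) \<in> ?G"
    note g = G.conflationD(6)[OF fg]
    show "(f, g) \<in> proj_generated C E (Proj C ?G)"
    proof (rule proj_generatedI[OF PO])
      show "(f, g) \<in> E" using fg proj_generated_subset by blast
      fix P u assume P: "P \<in> Proj C ?G" and u: "u \<in> Hom C P (Cod C g)"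
      obtain Q i g' h' where ig: "(i, g') \<in> ?G" and g': "g' \<in> Hom C Q P"
        and h': "h' \<in> Hom C Q (Dom C g)" and pb: "is_pullback C g u g' h'"
        using G.pullback_along[OF fg u] by metis
      have "splits C i g'" using P ig HomD[OF g'] by (auto simp: Proj_def)
      then obtain s where s: "s \<in> Hom C P Q" "g' \<cdot> s = Ident C P"
        using split_section[OF _ g'] by blast
      have "g \<cdot> (h' \<cdot> s) = (u \<cdot> g') \<cdot> s"
        using Comp_assoc[OF s(1) h' g] pb by (simp add: is_pullback_def)
      also have "\<dots> = u" using Comp_assoc[OF s(1) g' u] s(2) Comp_Ident_right[OF u] by simp
      finally show "\<exists>v \<in> Hom C P (Dom C g). g \<cdot> v = u" using Comp_Hom[OF s(1) h'] by blast
    qed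
  qed
qed

lemma right_perp_antimono: "\<A> \<subseteq> \<B> \<Longrightarrow> right_perp C E \<B> \<subseteq> right_perp C E \<A>"
  by (auto simp: right_perp_def)

lemma cotorsion_pair_Proj:
  assumes "(\<A>, \<B>) \<in> cotorsion_pairs C E"
  shows "Div C E (proj_generated C E \<A>) = \<B>" and "Proj C (proj_generated C E \<A>) = \<A>"
proof -
  have A: "\<A> \<subseteq> Obj C" "right_perp C E \<A> = \<B>" "left_perp C E \<B> = \<A>"
    using assms by (auto simp: cotorsion_pairs_def)
  show "Div C E (proj_generated C E \<A>) = \<B>" using Div_proj_generated A by simp
  then show "Proj C (proj_generated C E \<A>) = \<A>"
    using subset_Proj_proj_generated Proj_proj_generated_subset A by blast
qed

text \<open>Exactness is left out of the target set, so that the statement can be instantiated in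
  the opposite category.\<close>

lemma cotorsion_pairs_bij_proj:
  "bij_betw (\<lambda>(\<A>, \<B>). proj_generated C E \<A>) (cotorsion_pairs C E)
    {G. (\<exists>\<M> \<subseteq> Obj C. G = proj_generated C E \<M>) \<and> Proj C G = left_perp C E (Div C E G)}"
  (is "bij_betw ?F _ ?R")
proof (rule bij_betw_byWitness[where f' = "\<lambda>G. (Proj C G, Div C E G)"])
  show "\<forall>a \<in> cotorsion_pairs C E. (Proj C (?F a), Div C E (?F a)) = a"
    using cotorsion_pair_Proj by auto
  show "\<forall>G \<in> ?R. ?F (Proj C G, Div C E G) = G"
    by (auto simp only: mem_Collect_eq case_prod_conv proj_generated_Proj)
  show "?F ` cotorsion_pairs C E \<subseteq> ?R"
  proof clarify
    fix \<A> \<B> assume AB: "(\<A>, \<B>) \<in> cotorsion_pairs C E"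
    then have "\<A> \<subseteq> Obj C" "left_perp C E \<B> = \<A>" by (auto simp: cotorsion_pairs_def)
    then show "(\<exists>\<M> \<subseteq> Obj C. proj_generated C E \<A> = proj_generated C E \<M>) \<and>
        Proj C (proj_generated C E \<A>) = left_perp C E (Div C E (proj_generated C E \<A>))"
      using cotorsion_pair_Proj[OF AB] by auto
  qed
  show "(\<lambda>G. (Proj C G, Div C E G)) ` ?R \<subseteq> cotorsion_pairs C E"
  proof clarify
    fix \<M> assume M: "\<M> \<subseteq> Obj C"
    let ?G = "proj_generated C E \<M>"
    assume Xu: "Proj C ?G = left_perp C E (Div C E ?G)"
    \<comment> \<open>One inclusion holds because \<open>Proj\<close> contains \<open>\<M>\<close>;
      the other is the unit of the orthogonality Galois connection, read through the Xu
      condition.\<close>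
    have "right_perp C E (Proj C ?G) \<subseteq> Div C E ?G"
      using right_perp_antimono[OF subset_Proj_proj_generated[OF M]] Div_proj_generated[OF M] by simp
    moreover have "Div C E ?G \<subseteq> right_perp C E (left_perp C E (Div C E ?G))"
      by (auto simp: right_perp_def left_perp_def Div_def)
    ultimately have "right_perp C E (Proj C ?G) = Div C E ?G" using Xu by simp
    then show "(Proj C ?G, Div C E ?G) \<in> cotorsion_pairs C E"
      using Xu by (auto simp: cotorsion_pairs_def Proj_def Div_def)
  qed
qed

text \<open>The projective bijection of \<open>opp C\<close>, conjugated by \<open>converse\<close>
  on structures and by \<open>prod.swap\<close> on pairs; the swap is why \<open>\<B>\<close>
  generates here.\<close>

lemma cotorsion_pairs_bij_inj:
  "bij_betw (\<lambda>(\<A>, \<B>). inj_generated C E \<B>) (cotorsion_pairs C E)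
    {G. (\<exists>\<M> \<subseteq> Obj C. G = inj_generated C E \<M>) \<and> Inj C G = right_perp C E (Flat C E G)}"
  (is "bij_betw ?F ?ct ?R")
proof -
  interpret op: conflation_class "opp C" "E\<inverse>" by (rule conflation_class_opp)
  let ?Rop = "{G. (\<exists>\<M> \<subseteq> Obj (opp C). G = proj_generated (opp C) (E\<inverse>) \<M>) \<and>
      Proj (opp C) G = left_perp (opp C) (E\<inverse>) (Div (opp C) (E\<inverse>) G)}"
  have mem: "G\<inverse> \<in> ?Rop \<longleftrightarrow> G \<in> ?R" for G
  proof -
    have "Flat C E G \<subseteq> Obj C" by (auto simp: Flat_def)
    then show ?thesis
      by (simp add: Proj_opp Div_opp left_perp_opp proj_generated_opp kernel_cokernel)
  qed
  have "bij_betw converse ?Rop ?R"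
  proof (rule bij_betw_byWitness[where f' = converse])
    show "converse ` ?Rop \<subseteq> ?R"
    proof (rule image_subsetI)
      fix G assume "G \<in> ?Rop"
      then show "G\<inverse> \<in> ?R" by (intro mem[THEN iffD1]) (simp only: converse_converse)
    qed
    show "converse ` ?R \<subseteq> ?Rop"
      by (intro image_subsetI mem[THEN iffD2])
  qed simp_all
  moreover have "bij_betw prod.swap ?ct (cotorsion_pairs (opp C) (E\<inverse>))"
    unfolding cotorsion_pairs_opp by (rule bij_betw_byWitness[where f' = prod.swap]) auto
  ultimately have "bij_betw (converse \<circ> (\<lambda>(\<A>, \<B>). proj_generated (opp C) (E\<inverse>) \<A>) \<circ> prod.swap) ?ct ?R"
    by (intro bij_betw_trans[OF _ bij_betw_trans[OF op.cotorsion_pairs_bij_proj]])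
  moreover have "converse \<circ> (\<lambda>(\<A>, \<B>). proj_generated (opp C) (E\<inverse>) \<A>) \<circ> prod.swap = ?F"
    by (auto simp: fun_eq_iff proj_generated_opp kernel_cokernel)
  ultimately show ?thesis by simp
qed

section \<open>Injectively generated classes\<close>

lemma conflation_class_inj_generated:
  assumes M: "\<M> \<subseteq> Obj C"
  shows "conflation_class C (inj_generated C E \<M>)"
proof -
  interpret op: conflation_class "opp C" "E\<inverse>" by (rule conflation_class_opp)
  interpret G: conflation_class "opp C" "(inj_generated C E \<M>)\<inverse>"
    using op.conflation_class_proj_generated[of \<M>] M
    by (simp add: proj_generated_opp kernel_cokernel)
  show ?thesis using G.conflation_class_opp by simp
qed

lemma inj_generated_iff:
  assumes "\<M> \<subseteq> Obj C"
  shows "(f, g) \<in> inj_generated C E \<M> \<longleftrightarrow> (f, g) \<in> E \<and>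
    (\<forall>M \<in> \<M>. \<forall>u \<in> Hom C (Dom C f) M. \<exists>v \<in> Hom C (Cod C f) M. v \<cdot> f = u)"
  using conflation_class.proj_generated_iff[OF conflation_class_opp, of \<M> g f] assms
  by (simp add: proj_generated_opp kernel_cokernel)

lemma inj_generated_lift:
  assumes "\<M> \<subseteq> Obj C" and "(f, g) \<in> inj_generated C E \<M>" and "M \<in> \<M>" and "u \<in> Hom C (Dom C f) M"
  shows "\<exists>v \<in> Hom C (Cod C f) M. v \<cdot> f = u"
  using assms inj_generated_iff by blast

end


section \<open>Exactness of the generated structures\<close>

locale exact_category = conflation_class C D for C :: "('o, 'm) precategory" (structure) and D +
  assumes Ident_deflation: "zero_object C Z \<Longrightarrow> Ident C Z \<in> deflations D"
    and deflation_Comp: "\<lbrakk>g \<in> deflations D; g' \<in> deflations D; Dom C g' = Cod C g\<rbrakk> \<Longrightarrow>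
      g' \<cdot> g \<in> deflations D"
begin

lemma exact_structure: "exact_structure C D"
  unfolding exact_structure_def
  using kernel_cokernel iso_closed Ident_deflation deflation_Comp pullback_exists pushout_exists
  by auto

lemma exact_structure_proj_generated:
  assumes M: "\<M> \<subseteq> Obj C"
  shows "exact_structure C (proj_generated C D \<M>)"
proof -
  interpret G: conflation_class C "proj_generated C D \<M>" by (rule conflation_class_proj_generated[OF M])
  have "exact_category C (proj_generated C D \<M>)"
  proof
    show "Ident C Z \<in> deflations (proj_generated C D \<M>)" if Z: "zero_object C Z" for Z
    proof -
      obtain f where fg: "(f, Ident C Z) \<in> D" using Ident_deflation[OF Z] by (rule deflationsE)
      have "Ident C Z \<in> Hom C Z Z" using Z Ident_Hom by (simp add: zero_object_def)
      then have "(f, Ident C Z) \<in> proj_generated C D \<M>"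
        using proj_generatedI[OF M fg] Comp_Ident_left HomD(2,3) by metis
      then show ?thesis by (rule G.conflationD)
    qed
    show "g' \<cdot> g \<in> deflations (proj_generated C D \<M>)"
      if "g \<in> deflations (proj_generated C D \<M>)" "g' \<in> deflations (proj_generated C D \<M>)"
        and dom: "Dom C g' = Cod C g" for g g'
    proof -
      obtain f f' where fg: "(f, g) \<in> proj_generated C D \<M>" and fg': "(f', g') \<in> proj_generated C D \<M>"
        using \<open>g \<in> _\<close> \<open>g' \<in> _\<close> G.deflationsE by metis
      note g = G.conflationD(6)[OF fg] and g' = G.conflationD(6)[OF fg', unfolded dom]
      have "g' \<cdot> g \<in> deflations D"
        using deflation_Comp dom fg fg' proj_generated_subset by (meson conflationD(4) subsetD)
      then obtain k where k: "(k, g' \<cdot> g) \<in> D" by (rule deflationsE)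
      \<comment> \<open>Lift first through \<open>g'\<close>, then through \<open>g\<close>.\<close>
      have "\<exists>w \<in> Hom C M (Dom C (g' \<cdot> g)). (g' \<cdot> g) \<cdot> w = u"
        if MM: "M \<in> \<M>" and u: "u \<in> Hom C M (Cod C (g' \<cdot> g))" for M u
      proof -
        have "u \<in> Hom C M (Cod C g')" using u HomD[OF Comp_Hom[OF g g']] by simp
        then obtain v where v: "v \<in> Hom C M (Cod C g)" "g' \<cdot> v = u"
          using proj_generated_lift[OF M fg' MM] dom by auto
        then obtain w where w: "w \<in> Hom C M (Dom C g)" "g \<cdot> w = v"
          using proj_generated_lift[OF M fg MM] by blast
        then show ?thesis
          using v Comp_assoc[OF w(1) g g'] HomD[OF Comp_Hom[OF g g']] by auto
      qed
      then have "(k, g' \<cdot> g) \<in> proj_generated C D \<M>" using proj_generatedI[OF M k] by blast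
      then show ?thesis by (rule G.conflationD)
    qed
  qed
  then show ?thesis by (rule exact_category.exact_structure)
qed

text \<open>
  Composition of deflations is the one axiom that does not follow by duality. An arrow on
  the kernel of \<open>g' \<cdot> g\<close> is extended first from the kernel of \<open>g\<close> and then, after
  subtracting, from the kernel of \<open>g'\<close>.
\<close>

lemma exact_structure_inj_generated:
  assumes M: "\<M> \<subseteq> Obj C"
  shows "exact_structure C (inj_generated C D \<M>)"
proof -
  let ?G = "inj_generated C D \<M>"
  interpret G: conflation_class C ?G by (rule conflation_class_inj_generated[OF M])
  have sub: "?G \<subseteq> D" by (auto simp: inj_generated_def)
  have "exact_category C ?G"
  proof
    show "Ident C Z \<in> deflations ?G" if Z: "zero_object C Z" for Z
    proof -
      obtain f where fg: "(f, Ident C Z) \<in> D" using Ident_deflation[OF Z] by (rule deflationsE)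
      have id: "Ident C Z \<in> Hom C Z Z" using Z Ident_Hom by (simp add: zero_object_def)
      have f: "f \<in> Hom C (Dom C f) Z" using conflationD(5)[OF fg] HomD[OF id] by simp
      note X = HomD(4)[OF f] and ZO = HomD(5)[OF f]
      \<comment> \<open>A kernel of an identity is zero; being monic, it makes the identity of its
        domain zero, so the only \<open>u\<close> to extend is zero.\<close>
      have fnull: "f = Null C (Dom C f) Z"
        using Comp_Ident_left[OF f] conflationD(8)[OF fg] HomD[OF id] by simp
      have "u = Null C (Dom C f) M \<and> Null C Z M \<cdot> f = u" if u: "u \<in> Hom C (Dom C f) M" for M u
      proof -
        note MO = HomD(5)[OF u]
        have "f \<cdot> Ident C (Dom C f) = f \<cdot> Null C (Dom C f) (Dom C f)"
          using fnull Comp_Ident_right[OF f] Comp_Null_right[OF f X] by simp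
        then have "Ident C (Dom C f) = Null C (Dom C f) (Dom C f)"
          using kernel_mono[OF conflationD(1)[OF fg] f Ident_Hom[OF X] Null_Hom[OF X X]] by blast
        then have "u = Null C (Dom C f) M"
          using Comp_Ident_right[OF u] Comp_Null_right[OF u X] by simp
        then show ?thesis using Comp_Null_left[OF f MO] by simp
      qed
      then have "(f, Ident C Z) \<in> ?G"
        using inj_generated_iff[OF M] fg Null_Hom ZO HomD(3)[OF f] M by (metis subsetD)
      then show ?thesis by (rule G.conflationD)
    qed
    show "g' \<cdot> g \<in> deflations ?G"
      if "g \<in> deflations ?G" "g' \<in> deflations ?G" and dom: "Dom C g' = Cod C g" for g g'
    proof -
      obtain f f' where fg: "(f, g) \<in> ?G" and fg': "(f', g') \<in> ?G"
        using \<open>g \<in> _\<close> \<open>g' \<in> _\<close> G.deflationsE by metis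
      note f = G.conflationD(5)[OF fg] and g = G.conflationD(6)[OF fg]
      note f' = G.conflationD(5)[OF fg', unfolded dom] and g' = G.conflationD(6)[OF fg', unfolded dom]
      note gg = Comp_Hom[OF g g']
      have "g' \<cdot> g \<in> deflations D"
        using deflation_Comp dom fg fg' sub by (meson conflationD(4) subsetD)
      then obtain k where k: "(k, g' \<cdot> g) \<in> D" by (rule deflationsE)
      have kH: "k \<in> Hom C (Dom C k) (Dom C g)" using conflationD(5)[OF k] HomD[OF gg] by simp
      note K = HomD(4)[OF kH] and gk = Comp_Hom[OF kH g]
      have "g' \<cdot> (g \<cdot> k) = Null C (Dom C k) (Cod C g')"
        using conflationD(8)[OF k] Comp_assoc[OF kH g g'] HomD[OF gg] by simp
      then obtain p where p: "p \<in> Hom C (Dom C k) (Dom C f')" and f'p: "f' \<cdot> p = g \<cdot> k"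
        using kernel_lift[OF G.conflationD(1)[OF fg'] f' g' gk] by blast
      have "\<exists>w \<in> Hom C (Cod C k) M. w \<cdot> k = u" if MM: "M \<in> \<M>" and u: "u \<in> Hom C (Dom C k) M" for M u
      proof -
        \<comment> \<open>\<open>Q\<close> is the pullback of \<open>g\<close> along
          \<open>f'\<close>, with a conflation of \<open>?G\<close> joining the kernels of
          \<open>g\<close> and \<open>g'\<close>. The arrows \<open>c\<close> and \<open>e\<close>
          below make \<open>Dom C k\<close> a retract of \<open>Q\<close>, so \<open>u\<close> can
          be studied through \<open>u \<cdot> c\<close>.\<close>
        obtain Q i q h where iq: "(i, q) \<in> ?G" and i: "i \<in> Hom C (Dom C f) Q"
          and q: "q \<in> Hom C Q (Dom C f')" and h: "h \<in> Hom C Q (Dom C g)" and hi: "h \<cdot> i = f"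
          and pb: "is_pullback C g f' q h"
          using G.pullback_along[OF fg f'] by metis
        have gh: "g \<cdot> h = f' \<cdot> q" using pb by (simp add: is_pullback_def)
        obtain c where c: "c \<in> Hom C Q (Dom C k)" and kc: "k \<cdot> c = h"
        proof -
          have "(g' \<cdot> g) \<cdot> h = Null C Q (Cod C (g' \<cdot> g))"
            using Comp_assoc[OF h g g'] gh Comp_assoc[OF q f' g'] G.conflationD(8)[OF fg']
              Comp_Null_left[OF q HomD(5)[OF g']] HomD[OF gg] by simp
          then show thesis
            using kernel_lift[OF conflationD(1)[OF k] kH _ h] conflationD(6)[OF k] HomD[OF gg] that
            by auto
        qed
        obtain e where e: "e \<in> Hom C (Dom C k) Q" and he: "h \<cdot> e = k" and qe: "q \<cdot> e = p"
          using pullback_lift[OF pb kH, of p] p f'p HomD[OF q] by auto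
        have "k \<cdot> (c \<cdot> e) = k \<cdot> Ident C (Dom C k)"
          using Comp_assoc[OF e c kH] kc he Comp_Ident_right[OF kH] by simp
        then have ce: "c \<cdot> e = Ident C (Dom C k)"
          using kernel_mono[OF conflationD(1)[OF k] kH Comp_Hom[OF e c] Ident_Hom[OF K]] by simp
        note uc = Comp_Hom[OF c u] and X = HomD(4)[OF i]
        note uci = Comp_Hom[OF i uc]
        obtain w where w: "w \<in> Hom C (Dom C g) M" and wf: "w \<cdot> f = (u \<cdot> c) \<cdot> i"
          using inj_generated_lift[OF M fg MM uci] HomD(3)[OF f] by auto
        note wh = Comp_Hom[OF h w]
        \<comment> \<open>\<open>d\<close> is uc - wh, the part of \<open>u \<cdot> c\<close> that
          \<open>w\<close> does not account for. It vanishes on \<open>i\<close>, so it descends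
          along the cokernel \<open>q\<close> to the kernel of \<open>g'\<close>.\<close>
        obtain d where d: "d \<in> Hom C Q M" and dwh: "d \<boxplus> w \<cdot> h = u \<cdot> c"
          using difference[OF uc wh] by blast
        have "d \<cdot> i \<boxplus> (u \<cdot> c) \<cdot> i = (u \<cdot> c) \<cdot> i"
          using Comp_Plus_left[OF i d wh] dwh Comp_assoc[OF i h w] hi wf by simp
        then have "d \<cdot> i = Null C (Dom C f) M"
          using Plus_eq_right_imp_Null[OF Comp_Hom[OF i d] uci] by blast
        then obtain v where v: "v \<in> Hom C (Dom C f') M" and vq: "v \<cdot> q = d"
          using cokernel_factor[OF G.conflationD(2)[OF iq] i q d] by blast
        obtain w' where w': "w' \<in> Hom C (Cod C g) M" and w'f': "w' \<cdot> f' = v"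
          using inj_generated_lift[OF M fg' MM v] HomD(3)[OF f'] by auto
        note w'g = Comp_Hom[OF g w']
        have de: "d \<cdot> e = w' \<cdot> (g \<cdot> k)"
          using vq w'f' Comp_assoc[OF e q v] qe Comp_assoc[OF p f' w'] f'p by metis
        \<comment> \<open>The extension of \<open>u\<close> is w'g + w: its restriction to
          \<open>k\<close> is d + wh composed with \<open>e\<close>, which is uce.\<close>
        have "(w' \<cdot> g \<boxplus> w) \<cdot> k = d \<cdot> e \<boxplus> w \<cdot> (h \<cdot> e)"
          using Comp_Plus_left[OF kH w'g w] Comp_assoc[OF kH g w'] de he by simp
        also have "\<dots> = (u \<cdot> c) \<cdot> e"
          using Comp_Plus_left[OF e d wh] Comp_assoc[OF e h w] dwh by simp
        also have "\<dots> = u"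
          using Comp_assoc[OF e c u] ce Comp_Ident_right[OF u] by simp
        finally show ?thesis using Plus_Hom[OF w'g w] HomD(3)[OF kH] by auto
      qed
      then have "(k, g' \<cdot> g) \<in> ?G" using inj_generated_iff[OF M] k by blast
      then show ?thesis by (rule G.conflationD)
    qed
  qed
  then show ?thesis by (rule exact_category.exact_structure)
qed

end

lemma exact_categoryI:
  assumes "additive_category C" and "exact_structure C D"
  shows "exact_category C D"
proof -
  interpret additive_category C by fact
  show ?thesis
  proof
    obtain Z where "zero_object C Z" using zero_object_exists by blast
    \<comment> \<open>Nonemptiness comes from the identity of a zero object, which is a
      deflation.\<close>
    then have "deflations D \<noteq> {}" using assms(2) by (auto simp: exact_structure_def)
    then show "D \<noteq> {}" by (auto simp: deflations_def)
  qed (use assms(2) in \<open>unfold exact_structure_def, blast+\<close>)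
qed

theorem corollary3p9:
  fixes C :: "('o, 'm) precategory" and D :: "('m \<times> 'm) set"
  assumes "additive_category C" and "exact_structure C D"
  shows "bij_betw (\<lambda>(\<A>, \<B>). proj_generated C D \<A>) (cotorsion_pairs C D) (proj_Xu_structures C D) \<and>
         bij_betw (\<lambda>(\<A>, \<B>). inj_generated C D \<B>) (cotorsion_pairs C D) (inj_Xu_structures C D) \<and>
         bij_betw (\<lambda>E. inj_generated C D (Div C D E)) (proj_Xu_structures C D) (inj_Xu_structures C D)"
proof -
  interpret exact_category C D using assms by (rule exact_categoryI)
  \<comment> \<open>The exactness clause in the definition is automatic for a generated class, so
    the target agrees with that of the bijection already obtained.\<close>
  have "proj_Xu_structures C D =
      {E. (\<exists>\<M> \<subseteq> Obj C. E = proj_generated C D \<M>) \<and> Proj C E = left_perp C D (Div C D E)}"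
    using exact_structure_proj_generated
    by (auto simp: proj_Xu_structures_def projectively_generated_def)
  then have proj: "bij_betw (\<lambda>(\<A>, \<B>). proj_generated C D \<A>) (cotorsion_pairs C D) (proj_Xu_structures C D)"
    using cotorsion_pairs_bij_proj by simp
  have "inj_Xu_structures C D =
      {E. (\<exists>\<M> \<subseteq> Obj C. E = inj_generated C D \<M>) \<and> Inj C E = right_perp C D (Flat C D E)}"
    using exact_structure_inj_generated
    by (auto simp: inj_Xu_structures_def injectively_generated_def)
  then have inj: "bij_betw (\<lambda>(\<A>, \<B>). inj_generated C D \<B>) (cotorsion_pairs C D) (inj_Xu_structures C D)"
    using cotorsion_pairs_bij_inj by simp
  \<comment> \<open>On the structure generated by \<open>\<A>\<close>, \<open>Div\<close> returns
    \<open>\<B>\<close>. The composite is therefore the second bijection, and cancelling the first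
    one leaves the third.\<close>
  have "bij_betw ((\<lambda>E. inj_generated C D (Div C D E)) \<circ> (\<lambda>(\<A>, \<B>). proj_generated C D \<A>))
      (cotorsion_pairs C D) (inj_Xu_structures C D)"
    using inj by (rule bij_betw_cong[THEN iffD1, rotated]) (auto simp: cotorsion_pair_Proj)
  then show ?thesis using proj inj bij_betw_comp_iff[OF proj] by blast
qed

end
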